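(* Let $\mathcal{D}$ be a $C^1_c(\mathbb{R}^2)$-stable space of bounded real functions on a nonempty set $X$ and $(\mathcal{E},\mathcal{D})$ a sup-norm-closable bilinear form on which normal contractions operate. Then for every $f\in\mathcal{D}$ the linear functional $L_f(h):=2\mathcal{E}(fh,f)-\mathcal{E}(f^2,h)$, $h\in\mathcal{D}$, is positive and bounded with $\|L_f\|_{\mathcal{D}'}\le 2\mathcal{E}(f)$, and for every normal contraction $F$ one has $L_{F(f)}\le L_f$, i.e. $L_f(h)-L_{F(f)}(h)\ge0$ for all $h\in\mathcal{D}^+$.
   Context: $\|\cdot\|_{\sup}$ is the supremum norm, $\|L\|_{\mathcal{D}'}=\sup\{|L(h)|:h\in\mathcal{D},\|h\|_{\sup}\le1\}$, $\mathcal{D}^+$ the nonnegative elements. A bilinear form is a symmetric nonnegative definite bilinear map $\mathcal{E}:\mathcal{D}\times\mathcal{D}\to\mathbb{R}$, $\mathcal{E}(f):=\mathcal{E}(f,f)$. A normal contraction is $F:\mathbb{R}\to\mathbb{R}$ with $F(0)=0$ and $|F(x)-F(y)|\le|x-y|$; normal contractions operate on $(\mathcal{E},\mathcal{D})$ if $F(f)\in\mathcal{D}$ and $\mathcal{E}(F(f))\le\mathcal{E}(f)$ for all $f$, $F$ (this makes $\mathcal{D}$ an algebra). Sup-norm-closable: every $\mathcal{E}$-Cauchy $(f_n)\subset\mathcal{D}$ with $\|f_n\|_{\sup}\to0$ has $\mathcal{E}(f_n)\to0$. $\mathcal{D}$ is $C^1_c(\mathbb{R}^2)$-stable if $\varphi(f,g)\in\mathcal{D}$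 for all $f,g\in\mathcal{D}$ and all compactly supported $C^1$ functions $\varphi$ on $\mathbb{R}^2$ with $\varphi(0)=0$. A linear functional $L$ is positive if $h\ge0$ implies $L(h)\ge0$. *)

theory Defs
  imports "HOL-Analysis.Analysis"
begin

text \<open>Real functions on the (nonempty) ground type 'a play the role of functions on X.\<close>

definition sup_norm :: "('a \<Rightarrow> real) \<Rightarrow> real" where
  "sup_norm f = (SUP x. \<bar>f x\<bar>)"

definition bounded_fun :: "('a \<Rightarrow> real) \<Rightarrow> bool" where
  "bounded_fun f \<longleftrightarrow> (\<exists>B. \<forall>x. \<bar>f x\<bar> \<le> B)"

definition bdd_fun_space :: "('a \<Rightarrow> real) set \<Rightarrow> bool" where
  "bdd_fun_space D \<longleftrightarrow>
     (\<forall>f\<in>D. bounded_fun f) \<and> (\<lambda>x. 0) \<in> D \<and>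
     (\<forall>f\<in>D. \<forall>g\<in>D. (\<lambda>x. f x + g x) \<in> D) \<and>
     (\<forall>c. \<forall>f\<in>D. (\<lambda>x. c * f x) \<in> D)"

definition bilinear_form_on :: "('a \<Rightarrow> real) set \<Rightarrow> (('a \<Rightarrow> real) \<Rightarrow> ('a \<Rightarrow> real) \<Rightarrow> real) \<Rightarrow> bool" where
  "bilinear_form_on D E \<longleftrightarrow>
     (\<forall>f\<in>D. \<forall>g\<in>D. E f g = E g f) \<and>
     (\<forall>f\<in>D. \<forall>g\<in>D. \<forall>h\<in>D. E (\<lambda>x. f x + g x) h = E f h + E g h) \<and>
     (\<forall>c. \<forall>f\<in>D. \<forall>h\<in>D. E (\<lambda>x. c * f x) h = c * E f h) \<and>
     (\<forall>f\<in>D. E f f \<ge> 0)"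

definition normal_contraction :: "(real \<Rightarrow> real) \<Rightarrow> bool" where
  "normal_contraction F \<longleftrightarrow> F 0 = 0 \<and> (\<forall>x y. \<bar>F x - F y\<bar> \<le> \<bar>x - y\<bar>)"

definition normal_contractions_operate :: "('a \<Rightarrow> real) set \<Rightarrow> (('a \<Rightarrow> real) \<Rightarrow> ('a \<Rightarrow> real) \<Rightarrow> real) \<Rightarrow> bool" where
  "normal_contractions_operate D E \<longleftrightarrow>
     (\<forall>F. normal_contraction F \<longrightarrow>
        (\<forall>f\<in>D. (\<lambda>x. F (f x)) \<in> D \<and> E (\<lambda>x. F (f x)) (\<lambda>x. F (f x)) \<le> E f f))"

definition sup_norm_closable :: "('a \<Rightarrow> real) set \<Rightarrow> (('a \<Rightarrow> real) \<Rightarrow> ('a \<Rightarrow> real) \<Rightarrow> real) \<Rightarrow> bool" where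
  "sup_norm_closable D E \<longleftrightarrow>
     (\<forall>fs :: nat \<Rightarrow> ('a \<Rightarrow> real).
        (\<forall>n. fs n \<in> D) \<longrightarrow>
        (\<forall>e>0. \<exists>N. \<forall>m\<ge>N. \<forall>n\<ge>N. E (\<lambda>x. fs n x - fs m x) (\<lambda>x. fs n x - fs m x) < e) \<longrightarrow>
        (\<lambda>n. sup_norm (fs n)) \<longlonglongrightarrow> 0 \<longrightarrow>
        (\<lambda>n. E (fs n) (fs n)) \<longlonglongrightarrow> 0)"

definition C1c :: "(real \<times> real \<Rightarrow> real) \<Rightarrow> bool" where
  "C1c \<phi> \<longleftrightarrow>
     (\<exists>D :: real \<times> real \<Rightarrow> ((real \<times> real) \<Rightarrow>\<^sub>L real).
        (\<forall>z. (\<phi> has_derivative blinfun_apply (D z)) (at z)) \<and> continuous_on UNIV D) \<and>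
     compact (closure {z. \<phi> z \<noteq> 0})"

definition C1c_stable :: "('a \<Rightarrow> real) set \<Rightarrow> bool" where
  "C1c_stable D \<longleftrightarrow>
     (\<forall>\<phi>. C1c \<phi> \<and> \<phi> (0, 0) = 0 \<longrightarrow> (\<forall>f\<in>D. \<forall>g\<in>D. (\<lambda>x. \<phi> (f x, g x)) \<in> D))"

definition Lf :: "(('a \<Rightarrow> real) \<Rightarrow> ('a \<Rightarrow> real) \<Rightarrow> real) \<Rightarrow> ('a \<Rightarrow> real) \<Rightarrow> ('a \<Rightarrow> real) \<Rightarrow> real" where
  "Lf E f h = 2 * E (\<lambda>x. f x * h x) f - E (\<lambda>x. (f x)\<^sup>2) h"

definition dual_vals :: "('a \<Rightarrow> real) set \<Rightarrow> (('a \<Rightarrow> real) \<Rightarrow> real) \<Rightarrow> real set" where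
  "dual_vals D L = {\<bar>L h\<bar> | h. h \<in> D \<and> sup_norm h \<le> 1}"

definition dual_norm :: "('a \<Rightarrow> real) set \<Rightarrow> (('a \<Rightarrow> real) \<Rightarrow> real) \<Rightarrow> real" where
  "dual_norm D L = Sup (dual_vals D L)"

end

theory Submission
  imports Defs "HOL-Library.Function_Algebras"
begin

text \<open>For a positive linear functional \<open>\<nu>\<close> on all bounded functions put
  \<open>E\<^sub>\<nu>(f) = inf {E(g) + \<nu>((f - g)\<^sup>2) | g \<in> D}\<close>. This is a quadratic form on the bounded functions,
  dominated by the supremum norm, on which normal contractions still operate. On functions that are
  constant on the level sets of a step function it is a matrix with nonpositive off-diagonal entries
  and nonnegative row sums, for which the claims are immediate; step functions are uniformly dense.
  Closability makes \<open>E\<close> lower semicontinuous in the supremum norm, and a separation argument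
  turns this into \<open>E(u) = sup\<^sub>\<nu> E\<^sub>\<nu>(u)\<close>. Since \<open>E\<^sub>\<nu>\<close> increases with \<open>\<nu>\<close>, finitely many
  values of \<open>E\<close> can be approximated simultaneously, so the claims pass to \<open>E\<close>.\<close>

text \<open>The matrix argument cannot be run on \<open>E\<close> itself: \<open>D\<close> need not
  contain step functions or the constant 1, and \<open>E\<close> need not be continuous in the
  supremum norm. Letting the approximating form act on every bounded function, with the bound nu(1)
  times the squared supremum norm, supplies both. The obstacle in the separation is that lower
  semicontinuity speaks of uniform distance, whereas nu((u - g)^2) is a mean square. A single nu can
  replace the supremum because the functions g with E(g) < E(u) - eps form a convex set; this is
  Hahn-Banach for the sublinear functional sup. As X carries no measure or topology, nu is just a
  positive linear functional, without countable additivity. For fixed f and h, L_f(h) combines two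
  polarised values of \<open>E\<close>, hence four values of the quadratic form, so approximating
  the quadratic form at finitely many functions is enough. The factor 2 comes from L_f(1) = 2 E(f) -
  E(f^2, 1) for the approximating form, whose last term is subtracted and nonnegative because
  truncation at 1 is a normal contraction.\<close>

definition scl :: "real \<Rightarrow> ('a \<Rightarrow> real) \<Rightarrow> 'a \<Rightarrow> real" (infixr "\<odot>" 75) where
  "c \<odot> u = (\<lambda>x. c * u x)"

lemma scl_apply [simp]: "(c \<odot> u) x = c * u x"
  by (simp add: scl_def)

section \<open>Bounded functions and sums of infima\<close>

lemma bounded_funI: "(\<And>x. \<bar>u x\<bar> \<le> B) \<Longrightarrow> bounded_fun u"
  by (auto simp: bounded_fun_def)

lemma bounded_fun_bound:
  assumes "bounded_fun u"
  obtains B where "0 < B" "\<And>x. \<bar>u x\<bar> \<le> B"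
proof -
  obtain B where "\<And>x. \<bar>u x\<bar> \<le> B" using assms by (auto simp: bounded_fun_def)
  then have "\<And>x. \<bar>u x\<bar> \<le> max B 1" by (simp add: le_max_iff_disj)
  then show thesis using that[of "max B 1"] by simp
qed

lemma bounded_fun_add [simp]:
  assumes "bounded_fun u" "bounded_fun v"
  shows "bounded_fun (u + v)"
proof -
  obtain a b where "\<And>x. \<bar>u x\<bar> \<le> a" "\<And>x. \<bar>v x\<bar> \<le> b"
    using assms by (auto simp: bounded_fun_def)
  then have "\<bar>(u + v) x\<bar> \<le> a + b" for x
    unfolding plus_fun_apply by (intro order_trans[OF abs_triangle_ineq] add_mono)
  then show ?thesis by (rule bounded_funI)
qed

lemma bounded_fun_mult [simp]:
  assumes "bounded_fun u" "bounded_fun v"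
  shows "bounded_fun (u * v)"
proof -
  obtain a b where "\<And>x. \<bar>u x\<bar> \<le> a" "\<And>x. \<bar>v x\<bar> \<le> b"
    using assms by (auto simp: bounded_fun_def)
  then have "\<bar>(u * v) x\<bar> \<le> a * b" for x
    by (simp add: abs_mult) (meson abs_ge_zero mult_mono order_trans)
  then show ?thesis by (rule bounded_funI)
qed

lemma bounded_fun_scl [simp]:
  assumes "bounded_fun u"
  shows "bounded_fun (c \<odot> u)"
proof -
  obtain a where "\<And>x. \<bar>u x\<bar> \<le> a" using assms by (auto simp: bounded_fun_def)
  then have "\<bar>(c \<odot> u) x\<bar> \<le> \<bar>c\<bar> * a" for x
    by (simp add: abs_mult mult_left_mono)
  then show ?thesis by (rule bounded_funI)
qed

lemma bounded_fun_uminus [simp]: "bounded_fun u \<Longrightarrow> bounded_fun (- u)"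
  by (simp add: bounded_fun_def)

lemma bounded_fun_diff [simp]: "bounded_fun u \<Longrightarrow> bounded_fun v \<Longrightarrow> bounded_fun (u - v)"
  using bounded_fun_add[of u "- v"] by simp

lemma bounded_fun_const [simp]: "bounded_fun 0" "bounded_fun 1" "bounded_fun (\<lambda>_. c)"
  by (auto simp: bounded_fun_def)

lemma bounded_fun_contraction:
  assumes F: "normal_contraction F" and f: "bounded_fun f"
  shows "bounded_fun (\<lambda>x. F (f x))"
proof -
  obtain B where "\<And>x. \<bar>f x\<bar> \<le> B" using f by (auto simp: bounded_fun_def)
  moreover have "\<bar>F y\<bar> \<le> \<bar>y\<bar>" for y using F by (metis diff_zero normal_contraction_def)
  ultimately have "\<bar>F (f x)\<bar> \<le> B" for x by (meson order_trans)
  then show ?thesis by (rule bounded_funI)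
qed

text \<open>Infima over independent indices are added by freezing one index at a time. Subadditivity
  passes in this way to \<open>push\<close> and to infima along chains, and the parallelogram
  inequality to \<open>energy\<close>.\<close>

lemma le_cINF_add:
  fixes f :: "'i \<Rightarrow> real" and g :: "'j \<Rightarrow> real"
  assumes "I \<noteq> {}" "J \<noteq> {}" "\<And>i j. i \<in> I \<Longrightarrow> j \<in> J \<Longrightarrow> c \<le> f i + g j"
  shows "c \<le> (INF i\<in>I. f i) + (INF j\<in>J. g j)"
proof -
  have "c - f i \<le> (INF j\<in>J. g j)" if "i \<in> I" for i
    using assms that by (intro cINF_greatest) (auto simp: algebra_simps)
  then have "c - (INF j\<in>J. g j) \<le> (INF i\<in>I. f i)"
    using assms by (intro cINF_greatest) (auto simp: algebra_simps)
  then show ?thesis by simp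
qed

section \<open>Separation in the space of bounded functions\<close>

text \<open>Bounded functions are a predicate on the full function type, so both axioms are
  relativised and values at unbounded functions stay arbitrary.\<close>

definition sublinear :: "(('a \<Rightarrow> real) \<Rightarrow> real) \<Rightarrow> bool" where
  "sublinear p \<longleftrightarrow>
     (\<forall>u v. bounded_fun u \<longrightarrow> bounded_fun v \<longrightarrow> p (u + v) \<le> p u + p v) \<and>
     (\<forall>c u. 0 \<le> c \<longrightarrow> bounded_fun u \<longrightarrow> p (c \<odot> u) = c * p u)"

lemma sublinear_add: "sublinear p \<Longrightarrow> bounded_fun u \<Longrightarrow> bounded_fun v \<Longrightarrow> p (u + v) \<le> p u + p v"
  and sublinear_scl: "sublinear p \<Longrightarrow> 0 \<le> c \<Longrightarrow> bounded_fun u \<Longrightarrow> p (c \<odot> u) = c * p u"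
  by (auto simp: sublinear_def)

lemma sublinear_zero: "sublinear p \<Longrightarrow> p 0 = 0"
proof -
  have "0 \<odot> (0 :: 'a \<Rightarrow> real) = 0" by (simp add: fun_eq_iff)
  then show "sublinear p \<Longrightarrow> p 0 = 0" using sublinear_scl[of p 0 0] by simp
qed

lemma sublinear_uminus: "sublinear p \<Longrightarrow> bounded_fun u \<Longrightarrow> - p (- u) \<le> p u"
  using sublinear_add[of p u "- u"] sublinear_zero[of p] by simp

text \<open>The largest sublinear functional below \<open>p\<close> whose value at \<open>- k\<close> is at most \<open>- \<beta>\<close> for
  all \<open>k \<in> K\<close>.\<close>

definition push :: "(('a \<Rightarrow> real) \<Rightarrow> real) \<Rightarrow> ('a \<Rightarrow> real) set \<Rightarrow> real \<Rightarrow> ('a \<Rightarrow> real) \<Rightarrow> real" where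
  "push p K \<beta> w = (INF (t, k) \<in> {0..} \<times> K. p (w + t \<odot> k) - t * \<beta>)"

text \<open>The bound \<open>beta\<close> keeps the infimum in \<open>push\<close> finite, by
  subadditivity of \<open>p\<close> along t k = (w + t k) + (- w); convexity of \<open>K\<close>
  makes \<open>push\<close> subadditive. Two uses follow: a singleton \<open>K\<close> for linearity
  of minimal functionals, and a general convex \<open>K\<close> for separation.\<close>

locale pushing =
  fixes p :: "('a \<Rightarrow> real) \<Rightarrow> real" and K \<beta>
  assumes p: "sublinear p"
    and K: "K \<noteq> {}" "\<And>k. k \<in> K \<Longrightarrow> bounded_fun k"
    and conv: "\<And>k l s. k \<in> K \<Longrightarrow> l \<in> K \<Longrightarrow> 0 \<le> s \<Longrightarrow> s \<le> 1 \<Longrightarrow> s \<odot> k + (1 - s) \<odot> l \<in> K"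
    and beta: "\<And>k. k \<in> K \<Longrightarrow> \<beta> \<le> p k"
begin

lemma term_lower:
  assumes "bounded_fun w" "0 \<le> t" "k \<in> K"
  shows "- p (- w) \<le> p (w + t \<odot> k) - t * \<beta>"
proof -
  have "p (t \<odot> k) \<le> p (w + t \<odot> k) + p (- w)"
    using sublinear_add[OF p, of "w + t \<odot> k" "- w"] assms K by simp
  moreover have "t * \<beta> \<le> p (t \<odot> k)"
    using sublinear_scl[OF p, of t k] assms K beta by (simp add: mult_left_mono)
  ultimately show ?thesis by simp
qed

lemma push_lower:
  assumes "bounded_fun w" "0 \<le> t" "k \<in> K"
  shows "push p K \<beta> w \<le> p (w + t \<odot> k) - t * \<beta>"
proof -
  have "bdd_below ((\<lambda>(t, k). p (w + t \<odot> k) - t * \<beta>) ` ({0..} \<times> K))"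
    using term_lower[OF assms(1)] by (intro bdd_belowI2[where m = "- p (- w)"]) auto
  then show ?thesis
    unfolding push_def using assms by (intro cINF_lower2[of _ _ "(t, k)"]) auto
qed

lemma push_greatest:
  assumes "\<And>t k. 0 \<le> t \<Longrightarrow> k \<in> K \<Longrightarrow> c \<le> p (w + t \<odot> k) - t * \<beta>"
  shows "c \<le> push p K \<beta> w"
  unfolding push_def using assms K by (intro cINF_greatest) auto

lemma push_le: "bounded_fun w \<Longrightarrow> push p K \<beta> w \<le> p w"
proof -
  assume w: "bounded_fun w"
  obtain k where "k \<in> K" using K by blast
  moreover have "w + 0 \<odot> k = w" by (simp add: fun_eq_iff)
  ultimately show ?thesis using push_lower[OF w, of 0 k] by simp
qed

lemma push_uminus: "k \<in> K \<Longrightarrow> push p K \<beta> (- k) \<le> - \<beta>"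
proof -
  assume k: "k \<in> K"
  have "- k + 1 \<odot> k = 0" by (simp add: fun_eq_iff)
  then show ?thesis using push_lower[of "- k" 1 k] K k sublinear_zero[OF p] by simp
qed

lemma push_scl_le:
  assumes w: "bounded_fun w" and c: "0 < c"
  shows "push p K \<beta> (c \<odot> w) \<le> c * push p K \<beta> w"
proof -
  have "push p K \<beta> (c \<odot> w) / c \<le> push p K \<beta> w"
  proof (rule push_greatest)
    fix t k assume *: "0 \<le> (t::real)" "k \<in> K"
    have 1: "push p K \<beta> (c \<odot> w) \<le> p (c \<odot> w + (c * t) \<odot> k) - (c * t) * \<beta>"
      using w c * by (intro push_lower) auto
    have "c \<odot> w + (c * t) \<odot> k = c \<odot> (w + t \<odot> k)"
      by (simp add: fun_eq_iff algebra_simps)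
    then have 2: "p (c \<odot> w + (c * t) \<odot> k) = c * p (w + t \<odot> k)"
      using w c * K sublinear_scl[OF p, of c "w + t \<odot> k"] by simp
    show "push p K \<beta> (c \<odot> w) / c \<le> p (w + t \<odot> k) - t * \<beta>"
      using c 1 unfolding 2 pos_divide_le_eq[OF c] by (simp add: algebra_simps)
  qed
  then show ?thesis using c by (simp add: field_simps)
qed

lemma sublinear_push: "sublinear (push p K \<beta>)"
  unfolding sublinear_def
proof (intro conjI allI impI)
  fix u v :: "'a \<Rightarrow> real" assume u: "bounded_fun u" and v: "bounded_fun v"
  have "push p K \<beta> (u + v) \<le> (p (u + t \<odot> k) - t * \<beta>) + (p (v + s \<odot> l) - s * \<beta>)"
    if t: "0 \<le> t" "k \<in> K" and s: "0 \<le> s" "l \<in> K" for t k s l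
  proof -
    \<comment> \<open>Rays through \<open>K\<close> add up to a ray through \<open>K\<close>:
      \<open>m\<close> averages \<open>k\<close> and \<open>l\<close> with weights t/(t+s) and
      s/(t+s); for t = s = 0 any member serves.\<close>
    obtain m where m: "m \<in> K" "(t + s) \<odot> m = t \<odot> k + s \<odot> l"
    proof (cases "t + s = 0")
      case True
      then have "t = 0" "s = 0" using t s by auto
      then show thesis using t that[of k] by (simp add: fun_eq_iff)
    next
      case False
      define a where "a = t / (t + s)"
      have a: "(t + s) * a = t" "(t + s) * (1 - a) = s"
        using False by (simp_all add: a_def field_simps)
      let ?m = "a \<odot> k + (1 - a) \<odot> l"
      have "?m \<in> K" using False t s by (intro conv) (auto simp: a_def)
      moreover have "(t + s) \<odot> ?m = t \<odot> k + s \<odot> l"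
        unfolding fun_eq_iff by (simp add: distrib_left mult.assoc[symmetric] a)
      ultimately show thesis by (rule that)
    qed
    have 1: "push p K \<beta> (u + v) \<le> p ((u + v) + (t + s) \<odot> m) - (t + s) * \<beta>"
      using u v t s m by (intro push_lower) auto
    have 2: "(u + v) + (t + s) \<odot> m = (u + t \<odot> k) + (v + s \<odot> l)"
      unfolding m(2) by (simp add: add_ac)
    have "p ((u + t \<odot> k) + (v + s \<odot> l)) \<le> p (u + t \<odot> k) + p (v + s \<odot> l)"
      using u v t s K by (intro sublinear_add[OF p]) auto
    then show ?thesis using 1 unfolding 2 distrib_right by linarith
  qed
  then show "push p K \<beta> (u + v) \<le> push p K \<beta> u + push p K \<beta> v"
    unfolding push_def[of p K \<beta> u] push_def[of p K \<beta> v] using K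
    by (intro le_cINF_add) auto
next
  fix c :: real and u :: "'a \<Rightarrow> real" assume c: "0 \<le> c" and u: "bounded_fun u"
  show "push p K \<beta> (c \<odot> u) = c * push p K \<beta> u"
  proof (cases "c = 0")
    case True
    have "push p K \<beta> 0 = 0"
    proof (rule antisym)
      show "push p K \<beta> 0 \<le> 0" using push_le[of 0] sublinear_zero[OF p] by simp
      show "0 \<le> push p K \<beta> 0"
        using term_lower[of 0] sublinear_zero[OF p] by (intro push_greatest) auto
    qed
    moreover have "c \<odot> u = 0" using True by (simp add: fun_eq_iff)
    ultimately show ?thesis using True by simp
  next
    case False
    then have "0 < c" using c by simp
    moreover have "(1 / c) \<odot> c \<odot> u = u" using False by (simp add: fun_eq_iff)
    ultimately show ?thesis
      using push_scl_le[OF u, of c] push_scl_le[of "c \<odot> u" "1 / c"] u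
      by (simp add: field_simps)
  qed
qed

end

text \<open>Zorn's lemma for the reversed pointwise order. An infimum along a chain stays finite
  because each member satisfies q(u) \<ge> - q(- u) \<ge> - p0(- u).\<close>

lemma exists_minimal_sublinear:
  fixes p0 :: "('a \<Rightarrow> real) \<Rightarrow> real"
  assumes p0: "sublinear p0"
  obtains p where "sublinear p" "\<And>u. bounded_fun u \<Longrightarrow> p u \<le> p0 u"
    "\<And>q u. sublinear q \<Longrightarrow> (\<And>u. bounded_fun u \<Longrightarrow> q u \<le> p u) \<Longrightarrow> bounded_fun u \<Longrightarrow> q u = p u"
proof -
  \<comment> \<open>Normalising to 0 off the bounded functions makes the order on functions coincide
    with comparison on bounded functions.\<close>
  define A where "A = {p. sublinear p \<and> (\<forall>u. bounded_fun u \<longrightarrow> p u \<le> p0 u) \<and>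
    (\<forall>u :: 'a \<Rightarrow> real. \<not> bounded_fun u \<longrightarrow> p u = 0)}"
  have restr: "(\<lambda>u. if bounded_fun u then q u else 0) \<in> A"
    if "sublinear q" "\<And>u. bounded_fun u \<Longrightarrow> q u \<le> p0 u" for q
    using that unfolding A_def by (auto simp: sublinear_def)
  have "\<exists>m\<in>A. \<forall>a\<in>A. a \<le> m \<longrightarrow> a = m"
  proof (rule predicate_Zorn)
    show "partial_order_on A (relation_of (\<lambda>p q. q \<le> p) A)"
      by (rule partial_order_on_relation_ofI) auto
    fix C assume "C \<in> Chains (relation_of (\<lambda>p q. q \<le> p) A)"
    then have CA: "C \<subseteq> A" and chain: "\<And>p q. p \<in> C \<Longrightarrow> q \<in> C \<Longrightarrow> q \<le> p \<or> p \<le> q"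
      by (auto simp: Chains_def relation_of_def)
    show "\<exists>m\<in>A. \<forall>p\<in>C. m \<le> p"
    proof (cases "C = {}")
      case True
      then show ?thesis using restr[OF p0] by auto
    next
      case False
      define m where "m = (\<lambda>u. if bounded_fun u then INF q\<in>C. q u else 0)"
      have bdd: "bdd_below ((\<lambda>q. q u) ` C)" if u: "bounded_fun u" for u
      proof (rule bdd_belowI2)
        fix q assume "q \<in> C"
        then have "sublinear q" "q (- u) \<le> p0 (- u)" using CA u by (auto simp: A_def)
        then show "- p0 (- u) \<le> q u" using sublinear_uminus[of q u] u by simp
      qed
      have m_le: "m u \<le> q u" if "q \<in> C" for q u
        using that bdd CA by (auto simp: m_def A_def intro: cINF_lower)
      have "sublinear m"
        unfolding sublinear_def
      proof (intro conjI allI impI)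
        fix u v :: "'a \<Rightarrow> real" assume u: "bounded_fun u" and v: "bounded_fun v"
        have "m (u + v) \<le> q u + r v" if qr: "q \<in> C" "r \<in> C" for q r
        proof -
          obtain s where s: "s \<in> C" "s \<le> q" "s \<le> r" using chain[of q r] qr by blast
          have "m (u + v) \<le> s (u + v)" using s m_le by blast
          also have "\<dots> \<le> s u + s v" using s CA u v by (intro sublinear_add) (auto simp: A_def)
          also have "\<dots> \<le> q u + r v" using s by (intro add_mono) (auto simp: le_fun_def)
          finally show ?thesis .
        qed
        then have "m (u + v) \<le> (INF q\<in>C. q u) + (INF q\<in>C. q v)"
          using False by (intro le_cINF_add) auto
        then show "m (u + v) \<le> m u + m v" using u v by (simp add: m_def)
      next
        fix c :: real and u :: "'a \<Rightarrow> real" assume c: "0 \<le> c" and u: "bounded_fun u"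
        have scl: "q (c \<odot> u) = c * q u" if "q \<in> C" "0 \<le> c" "bounded_fun u" for q c u
          using that CA by (intro sublinear_scl) (auto simp: A_def)
        have *: "m (c \<odot> u) \<le> c * m u" if "0 < c" "bounded_fun u" for c u
        proof -
          have "m (c \<odot> u) / c \<le> (INF q\<in>C. q u)"
          proof (rule cINF_greatest[OF False])
            fix q assume "q \<in> C"
            then show "m (c \<odot> u) / c \<le> q u"
              using m_le[of q "c \<odot> u"] scl[of q c u] that by (simp add: field_simps)
          qed
          then show ?thesis using that by (simp add: field_simps m_def)
        qed
        show "m (c \<odot> u) = c * m u"
        proof (cases "c = 0")
          case True
          have "(INF q\<in>C. q (c \<odot> u)) = (INF q\<in>C. 0)"
            using scl[of _ c u] c u True by (intro INF_cong) auto
          then show ?thesis using True u \<open>C \<noteq> {}\<close> by (simp add: m_def)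
        next
          case False
          moreover have "(1 / c) \<odot> c \<odot> u = u" using False by (simp add: fun_eq_iff)
          ultimately show ?thesis
            using *[of c u] *[of "1 / c" "c \<odot> u"] u c
            by (simp add: field_simps)
        qed
      qed
      moreover have "m u \<le> p0 u" if "bounded_fun u" for u
        using False CA m_le that unfolding A_def by (force intro: order_trans)
      ultimately have "m \<in> A" by (simp add: A_def m_def)
      then show ?thesis using m_le by (auto simp: le_fun_def)
    qed
  qed
  then obtain p where p: "p \<in> A" and min: "\<And>q. q \<in> A \<Longrightarrow> q \<le> p \<Longrightarrow> q = p" by blast
  show thesis
  proof
    show "sublinear p" "\<And>u. bounded_fun u \<Longrightarrow> p u \<le> p0 u" using p by (auto simp: A_def)
    fix q u assume q: "sublinear q" "\<And>u. bounded_fun u \<Longrightarrow> q u \<le> p u" and u: "bounded_fun (u :: 'a \<Rightarrow> real)"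
    let ?q = "\<lambda>u. if bounded_fun u then q u else 0"
    have "?q \<in> A" using q p by (intro restr) (auto simp: A_def intro: order_trans)
    moreover have "?q \<le> p" using q p by (auto simp: le_fun_def A_def)
    ultimately have "?q = p" by (rule min)
    from fun_cong[OF this, of u] show "q u = p u" using u by simp
  qed
qed

definition positive_functional :: "(('a \<Rightarrow> real) \<Rightarrow> real) \<Rightarrow> bool" where
  "positive_functional \<nu> \<longleftrightarrow>
     (\<forall>u v. bounded_fun u \<longrightarrow> bounded_fun v \<longrightarrow> \<nu> (u + v) = \<nu> u + \<nu> v) \<and>
     (\<forall>c u. bounded_fun u \<longrightarrow> \<nu> (c \<odot> u) = c * \<nu> u) \<and>
     (\<forall>u. bounded_fun u \<longrightarrow> (\<forall>x. 0 \<le> u x) \<longrightarrow> 0 \<le> \<nu> u)"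

text \<open>A minimal sublinear functional \<open>p\<close> coincides with \<open>push p {v} (p v)\<close>, which forces
  \<open>p (- v) \<le> - p v\<close>.\<close>

lemma exists_linear_below_sublinear:
  fixes p0 :: "('a \<Rightarrow> real) \<Rightarrow> real"
  assumes p0: "sublinear p0"
  obtains \<nu> where
    "\<And>u v. bounded_fun u \<Longrightarrow> bounded_fun v \<Longrightarrow> \<nu> (u + v) = \<nu> u + \<nu> v"
    "\<And>c u. bounded_fun u \<Longrightarrow> \<nu> (c \<odot> u) = c * \<nu> u"
    "\<And>u. bounded_fun u \<Longrightarrow> \<nu> u \<le> p0 u"
proof -
  obtain p where pm: "sublinear p" "\<And>u. bounded_fun u \<Longrightarrow> p u \<le> p0 u"
    "\<And>q u. sublinear q \<Longrightarrow> (\<And>u. bounded_fun u \<Longrightarrow> q u \<le> p u) \<Longrightarrow> bounded_fun u \<Longrightarrow> q u = p u"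
    by (rule exists_minimal_sublinear[OF p0]) blast
  have neg: "p (- v) = - p v" if v: "bounded_fun v" for v
  proof -
    interpret pushing p "{v}" "p v"
    proof
      fix k l :: "'a \<Rightarrow> real" and s :: real assume "k \<in> {v}" "l \<in> {v}"
      then show "s \<odot> k + (1 - s) \<odot> l \<in> {v}" by (simp add: fun_eq_iff algebra_simps)
    qed (use pm(1) v in simp_all)
    have "p (- v) = push p {v} (p v) (- v)"
      using pm(3)[OF sublinear_push push_le bounded_fun_uminus[OF v]] by simp
    also have "\<dots> \<le> - p v" by (rule push_uminus) simp
    finally show ?thesis using sublinear_uminus[OF pm(1), of v] v by simp
  qed
  show thesis
  proof
    fix u v :: "'a \<Rightarrow> real" assume u: "bounded_fun u" and v: "bounded_fun v"
    have "- u + - v = - (u + v)" by simp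
    then have "- p (u + v) \<le> - p u - p v"
      using sublinear_add[OF pm(1), of "- u" "- v"] neg u v
      by (metis bounded_fun_add bounded_fun_uminus diff_conv_add_uminus)
    then show "p (u + v) = p u + p v" using sublinear_add[OF pm(1) u v] by simp
  next
    fix c and u :: "'a \<Rightarrow> real" assume u: "bounded_fun u"
    show "p (c \<odot> u) = c * p u"
    proof (cases "0 \<le> c")
      case True
      then show ?thesis using sublinear_scl[OF pm(1)] u by blast
    next
      case False
      have "c \<odot> u = - ((- c) \<odot> u)" by (simp add: fun_eq_iff)
      then show ?thesis using neg[of "(- c) \<odot> u"] sublinear_scl[OF pm(1), of "- c" u] u False by simp
    qed
  next
    show "\<And>u. bounded_fun u \<Longrightarrow> p u \<le> p0 u" by (rule pm)
  qed
qed

lemma bounded_fun_bdd_above: "bounded_fun u \<Longrightarrow> bdd_above (range u)"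
  by (meson abs_le_D1 bdd_aboveI2 bounded_fun_def)

lemma le_SUP_bounded: "bounded_fun u \<Longrightarrow> u x \<le> (SUP x. u x)"
  by (intro cSUP_upper bounded_fun_bdd_above) auto

lemma sublinear_SUP: "sublinear (\<lambda>w :: 'a \<Rightarrow> real. SUP x. w x)"
  unfolding sublinear_def
proof (intro conjI allI impI)
  fix u v :: "'a \<Rightarrow> real" assume u: "bounded_fun u" and v: "bounded_fun v"
  show "(SUP x. (u + v) x) \<le> (SUP x. u x) + (SUP x. v x)"
    using le_SUP_bounded[OF u] le_SUP_bounded[OF v] by (intro cSUP_least) (auto intro: add_mono)
next
  fix c :: real and u :: "'a \<Rightarrow> real" assume c: "0 \<le> c" and u: "bounded_fun u"
  have *: "(SUP x. (c \<odot> u) x) \<le> c * (SUP x. u x)" if "0 \<le> c" "bounded_fun u" for c u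
    using le_SUP_bounded[OF that(2)] that by (intro cSUP_least) (auto intro: mult_left_mono)
  show "(SUP x. (c \<odot> u) x) = c * (SUP x. u x)"
  proof (cases "c = 0")
    case False
    moreover have "(1 / c) \<odot> c \<odot> u = u" using False by (simp add: fun_eq_iff)
    ultimately show ?thesis
      using *[OF c u] *[of "1 / c" "c \<odot> u"] c u
      by (simp add: field_simps del: scl_apply)
  qed simp
qed

text \<open>A minimax statement: the point \<open>x\<close> depends on \<open>k\<close>, the
  functional does not. Below \<open>push\<close> of the supremum, a linear functional is positive
  because its value at - u is at most sup(- u), and its value at - k is at most
  \<open>- \<beta>\<close>.\<close>

lemma exists_positive_functional_ge:
  fixes K :: "('a \<Rightarrow> real) set"
  assumes K: "K \<noteq> {}" "\<And>k. k \<in> K \<Longrightarrow> bounded_fun k"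
    and conv: "\<And>k l s. k \<in> K \<Longrightarrow> l \<in> K \<Longrightarrow> 0 \<le> s \<Longrightarrow> s \<le> 1 \<Longrightarrow> s \<odot> k + (1 - s) \<odot> l \<in> K"
    and beta: "\<And>k. k \<in> K \<Longrightarrow> \<exists>x. \<beta> \<le> k x"
  obtains \<nu> where "positive_functional \<nu>" "\<And>k. k \<in> K \<Longrightarrow> \<beta> \<le> \<nu> k"
proof -
  interpret pushing "\<lambda>w. SUP x. w x" K \<beta>
  proof
    fix k assume "k \<in> K"
    then show "\<beta> \<le> (SUP x. k x)"
      using beta K le_SUP_bounded by (meson order_trans)
  qed (use K conv sublinear_SUP in auto)
  let ?p = "push (\<lambda>w. SUP x. w x) K \<beta>"
  obtain \<nu> where \<nu>: "\<And>u v. bounded_fun u \<Longrightarrow> bounded_fun v \<Longrightarrow> \<nu> (u + v) = \<nu> u + \<nu> v"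
    "\<And>c u. bounded_fun u \<Longrightarrow> \<nu> (c \<odot> u) = c * \<nu> u"
    "\<And>u. bounded_fun u \<Longrightarrow> \<nu> u \<le> ?p u"
    using exists_linear_below_sublinear[OF sublinear_push] by metis
  have neg: "\<nu> (- u) = - \<nu> u" if "bounded_fun u" for u
  proof -
    have "- u = (- 1) \<odot> u" by (simp add: fun_eq_iff)
    then show ?thesis using \<nu>(2)[OF that, of "- 1"] by simp
  qed
  show thesis
  proof
    show "positive_functional \<nu>"
      unfolding positive_functional_def
    proof (intro conjI allI impI)
      fix u :: "'a \<Rightarrow> real" assume u: "bounded_fun u" "\<forall>x. 0 \<le> u x"
      have "\<nu> (- u) \<le> ?p (- u)" using \<nu> u by simp
      also have "\<dots> \<le> (SUP x. (- u) x)" using u by (intro push_le) auto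
      also have "\<dots> \<le> 0" using u by (intro cSUP_least) auto
      finally show "0 \<le> \<nu> u" using neg u by simp
    qed (use \<nu> in auto)
    fix k assume k: "k \<in> K"
    have "\<nu> (- k) \<le> ?p (- k)" using \<nu> K k by simp
    also have "\<dots> \<le> - \<beta>" using k by (rule push_uminus)
    finally show "\<beta> \<le> \<nu> k" using neg K k by simp
  qed
qed

section \<open>Approximation by forms bounded in the supremum norm\<close>

lemma positive_functional_add:
    "positive_functional \<nu> \<Longrightarrow> bounded_fun u \<Longrightarrow> bounded_fun v \<Longrightarrow> \<nu> (u + v) = \<nu> u + \<nu> v"
  and positive_functional_scl: "positive_functional \<nu> \<Longrightarrow> bounded_fun u \<Longrightarrow> \<nu> (c \<odot> u) = c * \<nu> u"
  and positive_functional_nonneg: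
    "positive_functional \<nu> \<Longrightarrow> bounded_fun u \<Longrightarrow> (\<And>x. 0 \<le> u x) \<Longrightarrow> 0 \<le> \<nu> u"
  by (auto simp: positive_functional_def)

lemma positive_functional_mono:
  assumes \<nu>: "positive_functional \<nu>" and uv: "bounded_fun u" "bounded_fun v" "\<And>x. u x \<le> v x"
  shows "\<nu> u \<le> \<nu> v"
proof -
  have "v = u + (v - u)" by simp
  then have "\<nu> v = \<nu> u + \<nu> (v - u)"
    using positive_functional_add[OF \<nu>, of u "v - u"] uv by simp
  moreover have "0 \<le> \<nu> (v - u)" using uv by (intro positive_functional_nonneg[OF \<nu>]) auto
  ultimately show ?thesis by simp
qed

lemma positive_functional_zero: "positive_functional \<nu> \<Longrightarrow> \<nu> 0 = 0"
  using positive_functional_add[of \<nu> 0 0] by simp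

lemma positive_functional_square_nonneg: "positive_functional \<nu> \<Longrightarrow> bounded_fun f \<Longrightarrow> 0 \<le> \<nu> (f * f)"
  using positive_functional_nonneg[of \<nu> "f * f"] by simp

locale contraction_form =
  fixes D :: "('a \<Rightarrow> real) set" and E :: "('a \<Rightarrow> real) \<Rightarrow> ('a \<Rightarrow> real) \<Rightarrow> real"
  assumes space: "bdd_fun_space D"
    and form: "bilinear_form_on D E"
    and contractions: "normal_contractions_operate D E"
begin

lemma D_bdd [simp]: "f \<in> D \<Longrightarrow> bounded_fun f"
  and D_zero [simp]: "0 \<in> D"
  and D_add [simp]: "f \<in> D \<Longrightarrow> g \<in> D \<Longrightarrow> f + g \<in> D"
  and D_scl [simp]: "f \<in> D \<Longrightarrow> c \<odot> f \<in> D"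
  using space by (auto simp: bdd_fun_space_def zero_fun_def plus_fun_def scl_def)

lemma D_uminus [simp]: "f \<in> D \<Longrightarrow> - f \<in> D"
proof -
  have "- f = (- 1) \<odot> f" by (simp add: fun_eq_iff)
  then show "f \<in> D \<Longrightarrow> - f \<in> D" by simp
qed

lemma D_diff [simp]: "f \<in> D \<Longrightarrow> g \<in> D \<Longrightarrow> f - g \<in> D"
  using D_add[of f "- g"] by simp

lemma E_sym: "f \<in> D \<Longrightarrow> g \<in> D \<Longrightarrow> E f g = E g f"
  and E_add: "f \<in> D \<Longrightarrow> g \<in> D \<Longrightarrow> h \<in> D \<Longrightarrow> E (f + g) h = E f h + E g h"
  and E_scl: "f \<in> D \<Longrightarrow> h \<in> D \<Longrightarrow> E (c \<odot> f) h = c * E f h"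
  and E_nonneg: "f \<in> D \<Longrightarrow> 0 \<le> E f f"
  using form by (auto simp: bilinear_form_on_def plus_fun_def scl_def)

lemma E_add_right: "f \<in> D \<Longrightarrow> g \<in> D \<Longrightarrow> h \<in> D \<Longrightarrow> E h (f + g) = E h f + E h g"
  using E_sym E_add D_add by metis

lemma E_scl_right: "f \<in> D \<Longrightarrow> h \<in> D \<Longrightarrow> E h (c \<odot> f) = c * E h f"
  using E_sym E_scl D_scl by metis

lemma E_diff: "f \<in> D \<Longrightarrow> g \<in> D \<Longrightarrow> h \<in> D \<Longrightarrow> E (f - g) h = E f h - E g h"
  using E_add[of "f - g" g h] by simp

lemma E_diff_right: "f \<in> D \<Longrightarrow> g \<in> D \<Longrightarrow> h \<in> D \<Longrightarrow> E h (f - g) = E h f - E h g"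
  using E_add_right[of "f - g" g h] by simp

lemmas E_simps = E_add E_add_right E_diff E_diff_right E_scl E_scl_right

lemma E_zero [simp]: "E 0 0 = 0"
  using E_diff[of 0 0 0] by simp

lemma E_parallelogram:
  "f \<in> D \<Longrightarrow> g \<in> D \<Longrightarrow> E (f + g) (f + g) + E (f - g) (f - g) = 2 * E f f + 2 * E g g"
  by (simp add: E_simps)

lemma contraction_D: "normal_contraction F \<Longrightarrow> f \<in> D \<Longrightarrow> (\<lambda>x. F (f x)) \<in> D"
  and contraction_E: "normal_contraction F \<Longrightarrow> f \<in> D \<Longrightarrow>
    E (\<lambda>x. F (f x)) (\<lambda>x. F (f x)) \<le> E f f"
  using contractions by (auto simp: normal_contractions_operate_def)

lemma E_convex:
  assumes "f \<in> D" "g \<in> D" "0 \<le> s" "s \<le> 1"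
  shows "E (s \<odot> f + (1 - s) \<odot> g) (s \<odot> f + (1 - s) \<odot> g) \<le> s * E f f + (1 - s) * E g g"
proof -
  have "s * E f f + (1 - s) * E g g - E (s \<odot> f + (1 - s) \<odot> g) (s \<odot> f + (1 - s) \<odot> g)
      = s * (1 - s) * E (f - g) (f - g)"
    using assms E_sym[of f g] by (simp add: E_simps algebra_simps)
  moreover have "0 \<le> s * (1 - s) * E (f - g) (f - g)"
    using assms by (intro mult_nonneg_nonneg E_nonneg) auto
  ultimately show ?thesis by linarith
qed

text \<open>Infimal convolution of \<open>E\<close> with the square seminorm of
  \<open>\<nu>\<close>. For a closed form on an L^2 space with \<open>\<nu>\<close> equal to b times
  the integral it is the Deny-Yosida approximation b (f - b G_b f, f), with resolvent G_b. The
  argument \<open>f\<close> may lie outside \<open>D\<close>; only the competitors are in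
  \<open>D\<close>.\<close>

definition energy :: "(('a \<Rightarrow> real) \<Rightarrow> real) \<Rightarrow> ('a \<Rightarrow> real) \<Rightarrow> real" where
  "energy \<nu> f = (INF g\<in>D. E g g + \<nu> ((f - g) * (f - g)))"

lemma energy_lower:
  assumes "positive_functional \<nu>" "bounded_fun f" "g \<in> D"
  shows "energy \<nu> f \<le> E g g + \<nu> ((f - g) * (f - g))"
  unfolding energy_def
proof (rule cINF_lower)
  show "bdd_below ((\<lambda>g. E g g + \<nu> ((f - g) * (f - g))) ` D)"
  proof (rule bdd_belowI2)
    fix g assume "g \<in> D"
    then show "0 \<le> E g g + \<nu> ((f - g) * (f - g))"
      using assms positive_functional_square_nonneg[of \<nu> "f - g"] E_nonneg by simp
  qed
qed fact

lemma energy_greatest: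
  assumes "\<And>g. g \<in> D \<Longrightarrow> c \<le> E g g + \<nu> ((f - g) * (f - g))"
  shows "c \<le> energy \<nu> f"
  unfolding energy_def using assms D_zero by (intro cINF_greatest) blast+

lemma energy_nonneg: "positive_functional \<nu> \<Longrightarrow> bounded_fun f \<Longrightarrow> 0 \<le> energy \<nu> f"
  using energy_greatest[of 0 \<nu> f] positive_functional_square_nonneg[of \<nu> "f - _"] E_nonneg by simp

lemma energy_le_E: "positive_functional \<nu> \<Longrightarrow> f \<in> D \<Longrightarrow> energy \<nu> f \<le> E f f"
  using energy_lower[of \<nu> f f] positive_functional_zero[of \<nu>] by simp

lemma energy_le_nu: "positive_functional \<nu> \<Longrightarrow> bounded_fun f \<Longrightarrow> energy \<nu> f \<le> \<nu> (f * f)"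
  using energy_lower[of \<nu> f 0] by simp

lemma energy_add_mono:
  assumes "positive_functional \<nu>" "positive_functional \<mu>" "bounded_fun f"
  shows "energy \<nu> f \<le> energy (\<lambda>u. \<nu> u + \<mu> u) f" "energy \<mu> f \<le> energy (\<lambda>u. \<nu> u + \<mu> u) f"
proof -
  have "energy \<nu> f \<le> E g g + (\<nu> ((f - g) * (f - g)) + \<mu> ((f - g) * (f - g)))"
    "energy \<mu> f \<le> E g g + (\<nu> ((f - g) * (f - g)) + \<mu> ((f - g) * (f - g)))" if "g \<in> D" for g
    using energy_lower[OF assms(1,3) that] energy_lower[OF assms(2,3) that]
      positive_functional_square_nonneg[OF assms(1), of "f - g"] positive_functional_square_nonneg[OF assms(2), of "f - g"] assms that
    by simp_all
  then show "energy \<nu> f \<le> energy (\<lambda>u. \<nu> u + \<mu> u) f" "energy \<mu> f \<le> energy (\<lambda>u. \<nu> u + \<mu> u) f"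
    by (blast intro: energy_greatest)+
qed

text \<open>If g competes for f, then F(g) competes for F(f), and neither of the two terms
  grows.\<close>

lemma energy_contraction:
  assumes \<nu>: "positive_functional \<nu>" and f: "bounded_fun f" and F: "normal_contraction F"
  shows "energy \<nu> (\<lambda>x. F (f x)) \<le> energy \<nu> f"
proof (rule energy_greatest)
  fix g assume g: "g \<in> D"
  have lip: "\<bar>F x - F y\<bar> \<le> \<bar>x - y\<bar>" for x y
    using F by (auto simp: normal_contraction_def)
  have Ff: "bounded_fun (\<lambda>x. F (f x))" using F f by (rule bounded_fun_contraction)
  have "\<nu> (((\<lambda>x. F (f x)) - (\<lambda>x. F (g x))) * ((\<lambda>x. F (f x)) - (\<lambda>x. F (g x))))
      \<le> \<nu> ((f - g) * (f - g))"
  proof (rule positive_functional_mono[OF \<nu>])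
    fix x
    have "\<bar>F (f x) - F (g x)\<bar> * \<bar>F (f x) - F (g x)\<bar> \<le> \<bar>f x - g x\<bar> * \<bar>f x - g x\<bar>"
      using lip by (intro mult_mono) auto
    then show "(((\<lambda>x. F (f x)) - (\<lambda>x. F (g x))) * ((\<lambda>x. F (f x)) - (\<lambda>x. F (g x)))) x
        \<le> ((f - g) * (f - g)) x"
      by (simp add: abs_mult_self_eq)
  qed (use Ff contraction_D[OF F g] f g in auto)
  then show "energy \<nu> (\<lambda>x. F (f x)) \<le> E g g + \<nu> ((f - g) * (f - g))"
    using energy_lower[OF \<nu> Ff contraction_D[OF F g]] contraction_E[OF F g]
    by linarith
qed

text \<open>Competitors u for f and v for g give competitors u + v and u - v for f + g and f - g;
  both terms obey the parallelogram law.\<close>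

lemma energy_parallelogram_le:
  assumes \<nu>: "positive_functional \<nu>" and f: "bounded_fun f" "bounded_fun g"
  shows "energy \<nu> (f + g) + energy \<nu> (f - g) \<le> 2 * energy \<nu> f + 2 * energy \<nu> g"
proof -
  have "(energy \<nu> (f + g) + energy \<nu> (f - g)) / 2
    \<le> (E u u + \<nu> ((f - u) * (f - u))) + (E v v + \<nu> ((g - v) * (g - v)))"
    if u: "u \<in> D" "v \<in> D" for u v
  proof -
    define a b where "a = f - u" and "b = g - v"
    have ab: "bounded_fun a" "bounded_fun b" using f u by (auto simp: a_def b_def)
    have "(a + b) * (a + b) + (a - b) * (a - b) = 2 \<odot> (a * a) + 2 \<odot> (b * b)"
      by (simp add: fun_eq_iff algebra_simps)
    then have "\<nu> ((a + b) * (a + b)) + \<nu> ((a - b) * (a - b)) = 2 * \<nu> (a * a) + 2 * \<nu> (b * b)"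
      using ab by (simp add: positive_functional_add[OF \<nu>, symmetric]
        positive_functional_scl[OF \<nu>, symmetric])
    moreover have "f + g - (u + v) = a + b" "f - g - (u - v) = a - b"
      by (simp_all add: a_def b_def)
    ultimately show ?thesis
      using energy_lower[OF \<nu>, of "f + g" "u + v"] energy_lower[OF \<nu>, of "f - g" "u - v"] f u
        E_parallelogram[OF u] by (simp add: a_def[symmetric] b_def[symmetric])
  qed
  then have "(energy \<nu> (f + g) + energy \<nu> (f - g)) / 2 \<le> energy \<nu> f + energy \<nu> g"
    unfolding energy_def[of \<nu> f] energy_def[of \<nu> g] using D_zero by (intro le_cINF_add) blast+
  then show ?thesis by simp
qed

text \<open>Halving a competitor for 2 f gives one for f. This turns the parallelogram inequality,
  applied to f + g and f - g, into the reverse inequality.\<close>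

lemma energy_two:
  assumes \<nu>: "positive_functional \<nu>" and f: "bounded_fun f"
  shows "4 * energy \<nu> f \<le> energy \<nu> (2 \<odot> f)"
proof (rule energy_greatest)
  fix g assume g: "g \<in> D"
  define h where "h = (1/2) \<odot> g"
  have h: "h \<in> D" "g = 2 \<odot> h" using g by (auto simp: h_def fun_eq_iff)
  have "(2 \<odot> f - g) * (2 \<odot> f - g) = 4 \<odot> ((f - h) * (f - h))"
    by (simp add: h fun_eq_iff algebra_simps)
  then have "\<nu> ((2 \<odot> f - g) * (2 \<odot> f - g)) = 4 * \<nu> ((f - h) * (f - h))"
    using f h by (simp add: positive_functional_scl[OF \<nu>])
  then show "4 * energy \<nu> f \<le> E g g + \<nu> ((2 \<odot> f - g) * (2 \<odot> f - g))"
    using energy_lower[OF \<nu> f h(1)] h by (simp add: E_simps)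
qed

lemma energy_parallelogram:
  assumes \<nu>: "positive_functional \<nu>" and f: "bounded_fun f" "bounded_fun g"
  shows "energy \<nu> (f + g) + energy \<nu> (f - g) = 2 * energy \<nu> f + 2 * energy \<nu> g"
proof -
  have "(f + g) + (f - g) = 2 \<odot> f" "(f + g) - (f - g) = 2 \<odot> g" by (simp_all add: fun_eq_iff)
  then have "energy \<nu> (2 \<odot> f) + energy \<nu> (2 \<odot> g) \<le> 2 * energy \<nu> (f + g) + 2 * energy \<nu> (f - g)"
    using energy_parallelogram_le[OF \<nu>, of "f + g" "f - g"] f by simp
  then show ?thesis
    using energy_parallelogram_le[OF \<nu> f] energy_two[OF \<nu> f(1)] energy_two[OF \<nu> f(2)] by linarith
qed

end

section \<open>Closability, lower semicontinuity and approximation from below\<close>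

locale sup_closable_form = contraction_form +
  assumes closable: "sup_norm_closable D E"
begin

text \<open>Near-minimisers of \<open>E\<close> on the balls of radius \<open>1/n\<close> around \<open>u\<close> are \<open>E\<close>-Cauchy by the
  parallelogram law, since the balls are convex.\<close>

lemma lower_semicontinuous:
  assumes u: "u \<in> D" and eps: "0 < \<epsilon>"
  shows "\<exists>\<delta>>0. \<forall>g\<in>D. (\<forall>x. \<bar>u x - g x\<bar> \<le> \<delta>) \<longrightarrow> E u u - \<epsilon> \<le> E g g"
proof (rule ccontr)
  assume "\<not> ?thesis"
  then have neg: "\<exists>g\<in>D. (\<forall>x. \<bar>u x - g x\<bar> \<le> \<delta>) \<and> E g g < E u u - \<epsilon>" if "0 < \<delta>" for \<delta>
    using that by (meson not_le)
  define r where "r n = 1 / real (Suc n)" for n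
  have r: "0 < r n" "m \<le> n \<Longrightarrow> r n \<le> r m" for m n
    by (auto simp: r_def field_simps)
  have r0: "r \<longlonglongrightarrow> 0" unfolding r_def using LIMSEQ_inverse_real_of_nat by (simp add: field_simps)
  define S where "S n = {g\<in>D. \<forall>x. \<bar>u x - g x\<bar> \<le> r n}" for n
  define m where "m n = (INF g\<in>S n. E g g)" for n
  have bdd: "bdd_below ((\<lambda>g. E g g) ` S n)" for n
    by (rule bdd_belowI2[of _ 0]) (auto simp: S_def E_nonneg)
  have m_le: "m n \<le> E g g" if "g \<in> S n" for g n
    unfolding m_def using bdd that by (rule cINF_lower)
  have S_ne: "S n \<noteq> {}" and m_u: "m n < E u u - \<epsilon>" for n
  proof -
    obtain g where "g \<in> D" "\<forall>x. \<bar>u x - g x\<bar> \<le> r n" "E g g < E u u - \<epsilon>"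
      using neg[of "r n"] r by blast
    then show "S n \<noteq> {}" "m n < E u u - \<epsilon>" using m_le[of g n] by (auto simp: S_def)
  qed
  have "incseq m"
  proof (rule incseq_SucI)
    fix n
    have "S (Suc n) \<subseteq> S n" using r(2)[of n "Suc n"] unfolding S_def by (auto intro: order_trans)
    then show "m n \<le> m (Suc n)"
      unfolding m_def using bdd S_ne by (intro cINF_superset_mono) auto
  qed
  then obtain M where M: "m \<longlonglongrightarrow> M" "\<And>n. m n \<le> M"
    by (rule incseq_convergent[of m "E u u"]) (use m_u eps in \<open>auto intro!: less_imp_le[OF less_trans[OF m_u]]\<close>)
  have "\<exists>g\<in>S n. E g g < m n + r n" for n
    using cInf_lessD[of "(\<lambda>g. E g g) ` S n" "m n + r n"] S_ne r(1)[of n] unfolding m_def by auto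
  then obtain g where g: "\<And>n. g n \<in> S n" "\<And>n. E (g n) (g n) < m n + r n" by metis
  have gD [simp]: "g n \<in> D" for n using g(1) by (auto simp: S_def)
  define w where "w n = u - g n" for n
  have wD [simp]: "w n \<in> D" for n using u by (simp add: w_def)
  have cauchy: "E (w n - w k) (w n - w k) \<le> 4 * (M - m N) + 4 * r N" if "N \<le> n" "N \<le> k" for N n k
  proof -
    have "(1/2) \<odot> (g n + g k) \<in> S N"
    proof -
      have "\<bar>u x - (1/2) * (g n x + g k x)\<bar> \<le> r N" for x
      proof -
        have "\<bar>u x - g n x\<bar> \<le> r N" "\<bar>u x - g k x\<bar> \<le> r N"
          using g(1)[of n] g(1)[of k] r(2)[OF that(1)] r(2)[OF that(2)]
          unfolding S_def by (auto intro: order_trans)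
        then show ?thesis by (simp add: abs_le_iff) (simp add: field_simps)
      qed
      then show ?thesis by (simp add: S_def)
    qed
    from m_le[OF this] have "m N \<le> (1/2) * ((1/2) * E (g n + g k) (g n + g k))"
      by (simp only: E_scl E_scl_right D_add D_scl gD)
    then have "4 * m N \<le> E (g n + g k) (g n + g k)" by simp
    moreover have "w n - w k = g k - g n" by (simp add: w_def)
    moreover have "E (g k - g n) (g k - g n) + E (g n + g k) (g n + g k)
        = 2 * E (g n) (g n) + 2 * E (g k) (g k)"
      by (simp add: E_simps)
    ultimately show ?thesis
      using g(2)[of n] g(2)[of k] M(2)[of n] M(2)[of k] r(2)[OF that(1)] r(2)[OF that(2)]
      by (simp del: gD)
  qed
  have lim: "(\<lambda>N. 4 * (M - m N) + 4 * r N) \<longlonglongrightarrow> 4 * (M - M) + 4 * 0"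
    by (intro tendsto_intros M r0)
  have "(\<lambda>n. E (w n) (w n)) \<longlonglongrightarrow> 0"
  proof (rule closable[unfolded sup_norm_closable_def, rule_format])
    fix e :: real assume "0 < e"
    then have "\<forall>\<^sub>F N in sequentially. 4 * (M - m N) + 4 * r N < e"
      using order_tendstoD(2)[OF lim, of e] by simp
    then obtain N where N: "4 * (M - m N) + 4 * r N < e"
      by (auto simp: eventually_sequentially)
    show "\<exists>N. \<forall>k\<ge>N. \<forall>n\<ge>N. E (\<lambda>x. w n x - w k x) (\<lambda>x. w n x - w k x) < e"
    proof (intro exI allI impI)
      fix k n assume "N \<le> k" "N \<le> n"
      then show "E (\<lambda>x. w n x - w k x) (\<lambda>x. w n x - w k x) < e"
        using cauchy[of N n k] N by (simp add: fun_diff_def)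
    qed
  next
    have "0 \<le> sup_norm (w n) \<and> sup_norm (w n) \<le> r n" for n
    proof -
      have *: "\<bar>w n x\<bar> \<le> r n" for x using g(1)[of n] by (simp add: S_def w_def)
      then have "sup_norm (w n) \<le> r n" unfolding sup_norm_def by (intro cSUP_least) auto
      \<comment> \<open>Types are inhabited, so \<open>undefined\<close> is some point of X; it
        witnesses that the supremum norm is nonnegative.\<close>
      moreover have "\<bar>w n undefined\<bar> \<le> sup_norm (w n)"
        unfolding sup_norm_def using * by (intro cSUP_upper bdd_aboveI2) auto
      ultimately show ?thesis by simp
    qed
    then show "(\<lambda>n. sup_norm (w n)) \<longlonglongrightarrow> 0"
      by (intro real_tendsto_sandwich[OF _ _ tendsto_const r0]) auto
  qed simp
  \<comment> \<open>Expand u = g_n + w_n and bound the cross term by Young's inequality with weight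
    s, read off from E(s g_n - w_n) \<ge> 0. As E(w_n) tends to 0 and E(g_n) stays below E(u) - eps
    + r_n, the limit in n gives the claim for each fixed s.\<close>
  have "E u u \<le> (1 + s) * (E u u - \<epsilon>)" if s: "0 < s" for s
  proof -
    have le: "E u u \<le> (1 + s) * (E u u - \<epsilon>) + (1 + s) * r n + (1 + 1 / s) * E (w n) (w n)" for n
    proof -
      have "E (s \<odot> g n - w n) (s \<odot> g n - w n) \<ge> 0" by (intro E_nonneg) auto
      then have "2 * s * E (g n) (w n) \<le> s * s * E (g n) (g n) + E (w n) (w n)"
        using E_sym[of "g n" "w n"] by (simp add: E_simps algebra_simps)
      then have "2 * E (g n) (w n) \<le> s * E (g n) (g n) + E (w n) (w n) / s"
        using s by (simp add: field_simps)
      moreover have "u = g n + w n" by (simp add: w_def)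
      then have "E u u = E (g n) (g n) + 2 * E (g n) (w n) + E (w n) (w n)"
        using E_sym[of "g n" "w n"] by (simp add: E_simps)
      ultimately have "E u u \<le> (1 + s) * E (g n) (g n) + (1 + 1 / s) * E (w n) (w n)"
        by (simp add: algebra_simps)
      moreover have "(1 + s) * E (g n) (g n) \<le> (1 + s) * (E u u - \<epsilon> + r n)"
        using g(2)[of n] m_u[of n] s by (intro mult_left_mono) auto
      ultimately show ?thesis by (simp add: algebra_simps)
    qed
    have "(\<lambda>n. (1 + s) * (E u u - \<epsilon>) + (1 + s) * r n + (1 + 1 / s) * E (w n) (w n))
        \<longlonglongrightarrow> (1 + s) * (E u u - \<epsilon>) + (1 + s) * 0 + (1 + 1 / s) * 0"
      by (intro tendsto_intros r0) fact
    from LIMSEQ_le_const[OF this] le show ?thesis by auto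
  qed
  \<comment> \<open>With this s the gain s (E(u) - eps) is less than eps, a contradiction; the
    summand 1 covers E(u) = 0.\<close>
  from this[of "\<epsilon> / (E u u + 1)"]
  have "E u u \<le> (1 + \<epsilon> / (E u u + 1)) * (E u u - \<epsilon>)"
    using eps E_nonneg[OF u] by simp
  moreover have "\<epsilon> / (E u u + 1) * (E u u - \<epsilon>) < \<epsilon>"
  proof -
    have "\<epsilon> * (E u u - \<epsilon>) < \<epsilon> * (E u u + 1)" using eps by (intro mult_strict_left_mono) auto
    then show ?thesis using E_nonneg[OF u] by (simp add: field_simps)
  qed
  ultimately show False by (simp add: algebra_simps)
qed

text \<open>Call g bad if E(g) < E(u) - eps. Lower semicontinuity makes every bad g deviate from u
  by more than \<open>\<delta>\<close> somewhere, and separation yields one functional giving (u -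
  g)^2 at least \<open>\<delta>\<^sup>2\<close> for all bad g at once. A large multiple of it
  penalises bad competitors enough.\<close>

lemma energy_approx:
  assumes u: "u \<in> D" and eps: "0 < \<epsilon>"
  shows "\<exists>\<nu>. positive_functional \<nu> \<and> E u u - \<epsilon> \<le> energy \<nu> u"
proof -
  obtain \<delta> where d: "0 < \<delta>" "\<And>g. g \<in> D \<Longrightarrow> (\<And>x. \<bar>u x - g x\<bar> \<le> \<delta>) \<Longrightarrow> E u u - \<epsilon> \<le> E g g"
    using lower_semicontinuous[OF u eps] by blast
  define K where "K = {w. bounded_fun w \<and> (\<exists>g\<in>D. E g g < E u u - \<epsilon> \<and> (\<forall>x. ((u - g) * (u - g)) x \<le> w x))}"
  show ?thesis
  proof (cases "K = {}")
    \<comment> \<open>Separation asks for a nonempty set; without bad competitors the zero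
      functional already works.\<close>
    case True
    have "E u u - \<epsilon> \<le> E g g" if g: "g \<in> D" for g
    proof (rule ccontr)
      assume "\<not> ?thesis"
      then have "(u - g) * (u - g) \<in> K" using u g by (auto simp: K_def not_le intro!: bexI[of _ g])
      then show False using True by blast
    qed
    then have "E u u - \<epsilon> \<le> energy (\<lambda>_. 0) u" by (intro energy_greatest) auto
    moreover have "positive_functional (\<lambda>_ :: 'a \<Rightarrow> real. 0)" by (simp add: positive_functional_def)
    ultimately show ?thesis by blast
  next
    case False
    obtain \<nu> where \<nu>: "positive_functional \<nu>" "\<And>k. k \<in> K \<Longrightarrow> \<delta>\<^sup>2 \<le> \<nu> k"
    proof (rule exists_positive_functional_ge[of K "\<delta>\<^sup>2"])
      fix k assume "k \<in> K"
      then obtain g where g: "g \<in> D" "E g g < E u u - \<epsilon>" "\<And>x. ((u - g) * (u - g)) x \<le> k x"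
        by (auto simp: K_def)
      then obtain x where "\<delta> < \<bar>u x - g x\<bar>" using d(2)[of g] by (meson not_le)
      then have "\<delta>\<^sup>2 \<le> (u x - g x)\<^sup>2" using d(1) by (metis less_imp_le power2_abs power_mono)
      then show "\<exists>x. \<delta>\<^sup>2 \<le> k x" using g(3)[of x] by (auto simp: power2_eq_square intro: order_trans)
    next
      fix k l and s :: real assume k: "k \<in> K" "l \<in> K" and s: "0 \<le> s" "s \<le> 1"
      obtain g where g: "g \<in> D" "E g g < E u u - \<epsilon>" "\<And>x. ((u - g) * (u - g)) x \<le> k x"
        using k by (auto simp: K_def)
      obtain h where h: "h \<in> D" "E h h < E u u - \<epsilon>" "\<And>x. ((u - h) * (u - h)) x \<le> l x"
        using k by (auto simp: K_def)
      let ?g = "s \<odot> g + (1 - s) \<odot> h"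
      have "E ?g ?g \<le> s * E g g + (1 - s) * E h h" using g h s by (intro E_convex)
      also have "\<dots> < E u u - \<epsilon>" using g(2) h(2) s by (intro convex_bound_lt) auto
      finally have "E ?g ?g < E u u - \<epsilon>" .
      moreover have "((u - ?g) * (u - ?g)) x \<le> (s \<odot> k + (1 - s) \<odot> l) x" for x
      proof -
        define a b where "a = u x - g x" and "b = u x - h x"
        have "u x - (s * g x + (1 - s) * h x) = s * a + (1 - s) * b"
          by (simp add: a_def b_def algebra_simps)
        moreover have "s * (a * a) + (1 - s) * (b * b) - (s * a + (1 - s) * b) * (s * a + (1 - s) * b)
            = s * (1 - s) * ((a - b) * (a - b))"
          by (simp add: algebra_simps)
        moreover have "0 \<le> s * (1 - s) * ((a - b) * (a - b))" using s by simp
        moreover have "s * (a * a) \<le> s * k x" "(1 - s) * (b * b) \<le> (1 - s) * l x"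
          using g(3)[of x] h(3)[of x] s by (auto intro!: mult_left_mono simp: a_def b_def)
        ultimately show ?thesis by simp
      qed
      ultimately show "s \<odot> k + (1 - s) \<odot> l \<in> K"
        using g h k unfolding K_def by (auto intro!: bexI[of _ ?g])
    qed (use False in \<open>auto simp: K_def\<close>)
    \<comment> \<open>Chosen so that a penalty of at least \<open>\<delta>\<^sup>2\<close> is scaled
      up to at least E(u).\<close>
    define c where "c = E u u / \<delta>\<^sup>2"
    have c: "0 \<le> c" using E_nonneg[OF u] by (simp add: c_def)
    have "positive_functional (\<lambda>w. c * \<nu> w)"
      using \<nu>(1) c unfolding positive_functional_def by (auto simp: algebra_simps)
    moreover have "E u u - \<epsilon> \<le> energy (\<lambda>w. c * \<nu> w) u"
    proof (rule energy_greatest)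
      fix g assume g: "g \<in> D"
      have nn: "0 \<le> \<nu> ((u - g) * (u - g))"
        using g u positive_functional_square_nonneg[OF \<nu>(1), of "u - g"] by simp
      show "E u u - \<epsilon> \<le> E g g + c * \<nu> ((u - g) * (u - g))"
      proof (cases "E g g < E u u - \<epsilon>")
        case True
        then have "(u - g) * (u - g) \<in> K" using u g by (auto simp: K_def intro!: bexI[of _ g])
        from mult_left_mono[OF \<nu>(2)[OF this] c]
        have "E u u \<le> c * \<nu> ((u - g) * (u - g))" using d(1) by (simp add: c_def)
        then show ?thesis using E_nonneg[OF g] eps by linarith
      next
        case False
        then show ?thesis using mult_nonneg_nonneg[OF c nn] by linarith
      qed
    qed
    ultimately show ?thesis by blast
  qed
qed

lemma energy_approx_finite:
  assumes "finite W" "W \<subseteq> D" "0 < \<epsilon>"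
  shows "\<exists>\<nu>. positive_functional \<nu> \<and> (\<forall>u\<in>W. E u u - \<epsilon> \<le> energy \<nu> u)"
  using assms(1,2)
proof (induction rule: finite_induct)
  case empty
  have "positive_functional (\<lambda>_ :: 'a \<Rightarrow> real. 0)" by (simp add: positive_functional_def)
  then show ?case by blast
next
  case (insert w W)
  obtain \<nu> where \<nu>: "positive_functional \<nu>" "\<forall>u\<in>W. E u u - \<epsilon> \<le> energy \<nu> u" using insert by auto
  obtain \<mu> where \<mu>: "positive_functional \<mu>" "E w w - \<epsilon> \<le> energy \<mu> w"
    using energy_approx[OF _ assms(3), of w] insert.prems by auto
  have "positive_functional (\<lambda>u. \<nu> u + \<mu> u)"
    using \<nu>(1) \<mu>(1) unfolding positive_functional_def by (auto simp: algebra_simps)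
  moreover have "\<forall>u\<in>insert w W. E u u - \<epsilon> \<le> energy (\<lambda>u. \<nu> u + \<mu> u) u"
  proof
    fix u assume u: "u \<in> insert w W"
    then have "bounded_fun u" using insert.prems by auto
    note mono = energy_add_mono[OF \<nu>(1) \<mu>(1) this]
    show "E u u - \<epsilon> \<le> energy (\<lambda>u. \<nu> u + \<mu> u) u"
    proof (cases "u = w")
      case True
      then show ?thesis using \<mu>(2) mono(2) by (metis order_trans)
    next
      case False
      then have "E u u - \<epsilon> \<le> energy \<nu> u" using \<nu>(2) u by blast
      then show ?thesis using mono(1) by (rule order_trans)
    qed
  qed
  ultimately show ?case by blast
qed

end

section \<open>Contractive forms bounded in the supremum norm\<close>

text \<open>Cauchy's functional equation. Subtracting the linear candidate leaves an additive
  \<open>\<psi>\<close> vanishing on integers, so n \<open>\<psi>\<close>(c) is the value of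
  \<open>\<psi>\<close> at the fractional part of n c and stays bounded in n.\<close>

lemma additive_locally_bounded_linear:
  fixes \<phi> :: "real \<Rightarrow> real"
  assumes add: "\<And>s t. \<phi> (s + t) = \<phi> s + \<phi> t"
    and bound: "\<And>t. \<bar>t\<bar> \<le> 1 \<Longrightarrow> \<bar>\<phi> t\<bar> \<le> K"
  shows "\<phi> c = c * \<phi> 1"
proof -
  define \<psi> where "\<psi> t = \<phi> t - t * \<phi> 1" for t
  have padd: "\<psi> (s + t) = \<psi> s + \<psi> t" for s t by (simp add: \<psi>_def add algebra_simps)
  have p0: "\<psi> 0 = 0" using padd[of 0 0] by simp
  have nat: "\<psi> (real n * t) = real n * \<psi> t" for n t
    by (induction n) (simp_all add: p0 padd algebra_simps)
  have neg: "\<psi> (- t) = - \<psi> t" for t using padd[of t "- t"] p0 by simp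
  have p1: "\<psi> 1 = 0" by (simp add: \<psi>_def)
  have int: "\<psi> (of_int k) = 0" for k
  proof (cases "0 \<le> k")
    case True
    then show ?thesis using nat[of "nat k" 1] p1 by simp
  next
    case False
    then show ?thesis using nat[of "nat (- k)" 1] p1 neg[of "of_int k"] by simp
  qed
  have "real n * \<bar>\<psi> c\<bar> \<le> K + \<bar>\<phi> 1\<bar>" for n
  proof -
    define t where "t = frac (real n * c)"
    have t: "0 \<le> t" "t \<le> 1" by (auto simp: t_def frac_lt_1 less_imp_le)
    have "real n * c = of_int \<lfloor>real n * c\<rfloor> + t" by (simp add: t_def frac_def)
    then have "real n * \<psi> c = \<psi> t" using nat[of n c] padd int by (metis add_0)
    then have "real n * \<bar>\<psi> c\<bar> = \<bar>\<psi> t\<bar>" by (metis abs_mult abs_of_nat)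
    also have "\<dots> \<le> \<bar>\<phi> t\<bar> + \<bar>t * \<phi> 1\<bar>" unfolding \<psi>_def by (rule abs_triangle_ineq4)
    also have "\<dots> \<le> K + \<bar>\<phi> 1\<bar>"
      using t by (intro add_mono bound) (auto simp: abs_mult mult_left_le_one_le)
    finally show ?thesis .
  qed
  then have "\<bar>\<psi> c\<bar> \<le> 0" using ex_less_of_nat_mult[of "\<bar>\<psi> c\<bar>" "K + \<bar>\<phi> 1\<bar>"] by (meson not_le)
  then show ?thesis by (simp add: \<psi>_def)
qed

lemma normal_contraction_scale: "\<bar>t\<bar> \<le> 1 \<Longrightarrow> normal_contraction ((*) t)"
  unfolding normal_contraction_def
  by (simp add: abs_mult mult_left_le_one_le flip: right_diff_distrib)

lemma normal_contraction_abs: "normal_contraction abs"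
  by (auto simp: normal_contraction_def abs_triangle_ineq3)

lemma Lf_alt: "Lf B f h = 2 * B (f * h) f - B (f * f) h"
  by (simp add: Lf_def times_fun_def power2_eq_square)

text \<open>The properties of \<open>energy\<close> that the matrix argument uses. Bilinearity is
  not among them: it is recovered from the parallelogram law and contractivity.\<close>

locale bounded_quadratic_form =
  fixes N :: "('a \<Rightarrow> real) \<Rightarrow> real" and C :: real
  assumes nonneg: "bounded_fun f \<Longrightarrow> 0 \<le> N f"
    and parallelogram:
      "bounded_fun f \<Longrightarrow> bounded_fun g \<Longrightarrow> N (f + g) + N (f - g) = 2 * N f + 2 * N g"
    and contraction: "normal_contraction F \<Longrightarrow> bounded_fun f \<Longrightarrow> N (\<lambda>x. F (f x)) \<le> N f"
    and bound: "(\<And>x. \<bar>f x\<bar> \<le> 1) \<Longrightarrow> N f \<le> C"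
begin

definition A :: "('a \<Rightarrow> real) \<Rightarrow> ('a \<Rightarrow> real) \<Rightarrow> real" where
  "A f g = (N (f + g) - N (f - g)) / 4"

lemma N_zero: "N 0 = 0"
  using parallelogram[of 0 0] by simp

lemma N_uminus: "bounded_fun f \<Longrightarrow> N (- f) = N f"
  using parallelogram[of 0 f] N_zero by simp

lemma N_diff_commute: "bounded_fun f \<Longrightarrow> bounded_fun g \<Longrightarrow> N (f - g) = N (g - f)"
  using N_uminus[of "g - f"] by simp

lemma A_sym: "bounded_fun f \<Longrightarrow> bounded_fun g \<Longrightarrow> A f g = A g f"
  unfolding A_def by (simp add: N_diff_commute[of f g] add.commute)

lemma A_self: "bounded_fun f \<Longrightarrow> A f f = N f"
  unfolding A_def using parallelogram[of f f] N_zero by simp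

text \<open>The Jordan-von Neumann computation: among four parallelogram identities the values at y
  - z - x and y + z - x cancel.\<close>

lemma A_add:
  assumes "bounded_fun x" "bounded_fun y" "bounded_fun z"
  shows "A (x + y) z = A x z + A y z"
proof -
  have e: "x + z + y = x + y + z" "x - z + y = x + y - z" "y + z + x = x + y + z" "y - z + x = x + y - z"
    "x + z - y = - (y - z - x)" "x - z - y = - (y + z - x)"
    by (simp_all add: algebra_simps)
  have n: "N (- (y - z - x)) = N (y - z - x)" "N (- (y + z - x)) = N (y + z - x)"
    using assms by (simp_all only: N_uminus bounded_fun_diff bounded_fun_add)
  have cancel: "(p - q) / 4 = (p1 - q1) / 4 + (p2 - q2) / 4"
    if "p + a = 2 * p1 + 2 * c" "q + b = 2 * q1 + 2 * c" "p + b = 2 * p2 + 2 * d" "q + a = 2 * q2 + 2 * d"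
    for p q p1 q1 p2 q2 a b c d :: real
  proof -
    have "p - q = (p1 - q1) + (p2 - q2)" using that by linarith
    then show ?thesis by (simp add: add_divide_distrib)
  qed
  have "N (x + y + z) + N (y - z - x) = 2 * N (x + z) + 2 * N y"
    "N (x + y - z) + N (y + z - x) = 2 * N (x - z) + 2 * N y"
    "N (x + y + z) + N (y + z - x) = 2 * N (y + z) + 2 * N x"
    "N (x + y - z) + N (y - z - x) = 2 * N (y - z) + 2 * N x"
    using parallelogram[of "x + z" y] parallelogram[of "x - z" y]
      parallelogram[of "y + z" x] parallelogram[of "y - z" x] assms
    unfolding e n by simp_all
  then show ?thesis unfolding A_def by (rule cancel)
qed

lemma A_le_N:
  assumes "bounded_fun f" "bounded_fun g"
  shows "\<bar>A f g\<bar> \<le> (N f + N g) / 2"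
proof -
  have "0 \<le> N (f + g)" "0 \<le> N (f - g)" using assms by (simp_all add: nonneg)
  then show ?thesis unfolding A_def using parallelogram[OF assms] by (simp add: abs_le_iff)
qed

text \<open>Additivity in the scalar upgrades to homogeneity, since y \<mapsto> t y with |t| \<le> 1
  is a normal contraction and so bounds the values near 0.\<close>

lemma A_scl:
  assumes "bounded_fun f" "bounded_fun g"
  shows "A (c \<odot> f) g = c * A f g"
proof -
  have "A (c \<odot> f) g = c * A (1 \<odot> f) g"
  proof (rule additive_locally_bounded_linear)
    fix s t
    have "(s + t) \<odot> f = s \<odot> f + t \<odot> f" by (simp add: fun_eq_iff algebra_simps)
    then show "A ((s + t) \<odot> f) g = A (s \<odot> f) g + A (t \<odot> f) g"
      using assms by (simp add: A_add)
  next
    fix t :: real assume "\<bar>t\<bar> \<le> 1"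
    then have "N (t \<odot> f) \<le> N f"
      using contraction[OF normal_contraction_scale assms(1)] by (simp add: scl_def)
    moreover have "\<bar>A (t \<odot> f) g\<bar> \<le> (N (t \<odot> f) + N g) / 2" using assms by (intro A_le_N) auto
    ultimately show "\<bar>A (t \<odot> f) g\<bar> \<le> (N f + N g) / 2" by simp
  qed
  moreover have "1 \<odot> f = f" by (simp add: fun_eq_iff)
  ultimately show ?thesis by simp
qed

lemma A_add_right: "bounded_fun x \<Longrightarrow> bounded_fun y \<Longrightarrow> bounded_fun z \<Longrightarrow> A z (x + y) = A z x + A z y"
  using A_sym A_add bounded_fun_add by metis

lemma A_scl_right: "bounded_fun f \<Longrightarrow> bounded_fun g \<Longrightarrow> A g (c \<odot> f) = c * A g f"
  using A_sym A_scl bounded_fun_scl by metis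

lemma A_diff: "bounded_fun x \<Longrightarrow> bounded_fun y \<Longrightarrow> bounded_fun z \<Longrightarrow> A (x - y) z = A x z - A y z"
  using A_add[of "x - y" y z] by simp

lemma A_diff_right: "bounded_fun x \<Longrightarrow> bounded_fun y \<Longrightarrow> bounded_fun z \<Longrightarrow> A z (x - y) = A z x - A z y"
  using A_add_right[of "x - y" y z] by simp

lemma A_zero: "bounded_fun z \<Longrightarrow> A 0 z = 0"
  using A_diff[of 0 0 z] by simp

lemma A_sum:
  assumes "finite R" "\<And>i. i \<in> R \<Longrightarrow> bounded_fun (u i)" "bounded_fun v"
  shows "bounded_fun (\<lambda>x. \<Sum>i\<in>R. u i x) \<and> A (\<lambda>x. \<Sum>i\<in>R. u i x) v = (\<Sum>i\<in>R. A (u i) v)"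
  using assms(1,2)
proof (induction rule: finite_induct)
  case empty
  then show ?case using A_zero[OF assms(3)] by (simp add: zero_fun_def)
next
  case (insert i R)
  have "(\<lambda>x. \<Sum>i\<in>insert i R. u i x) = u i + (\<lambda>x. \<Sum>i\<in>R. u i x)"
    using insert.hyps by (simp add: fun_eq_iff)
  then show ?case using insert assms(3) by (simp add: A_add)
qed

lemma A_bound:
  assumes "\<And>x. \<bar>f x\<bar> \<le> a" "\<And>x. \<bar>g x\<bar> \<le> b" "0 < a" "0 < b"
  shows "\<bar>A f g\<bar> \<le> C * a * b"
proof -
  define f' g' where "f' = (1 / a) \<odot> f" and "g' = (1 / b) \<odot> g"
  have le: "\<bar>f' x\<bar> \<le> 1" "\<bar>g' x\<bar> \<le> 1" for x using assms by (auto simp: f'_def g'_def abs_mult)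
  then have b: "bounded_fun f'" "bounded_fun g'" by (auto intro: bounded_funI)
  have "f = a \<odot> f'" "g = b \<odot> g'" using assms by (auto simp: f'_def g'_def fun_eq_iff)
  then have "\<bar>A f g\<bar> = a * b * \<bar>A f' g'\<bar>"
    using b assms(3,4) by (simp add: A_scl A_scl_right abs_mult)
  also have "\<dots> \<le> a * b * C"
  proof -
    have "N f' \<le> C" "N g' \<le> C" using le by (blast intro: bound)+
    then show ?thesis using A_le_N[OF b] assms(3,4) by (intro mult_left_mono) auto
  qed
  finally show ?thesis by (simp add: mult_ac)
qed

text \<open>For disjoint supports the absolute value contracts f - g to f + g. This gives the sign
  of the off-diagonal entries.\<close>

lemma A_disjoint_nonpos:
  assumes f: "bounded_fun f" "bounded_fun g" "\<And>x. 0 \<le> f x" "\<And>x. 0 \<le> g x" "\<And>x. f x = 0 \<or> g x = 0"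
  shows "A f g \<le> 0"
proof -
  have "f + g = (\<lambda>x. \<bar>(f - g) x\<bar>)"
  proof
    fix x show "(f + g) x = \<bar>(f - g) x\<bar>" using f(3-5)[of x] by auto
  qed
  then have "N (f + g) \<le> N (f - g)"
    using contraction[OF normal_contraction_abs, of "f - g"] f by simp
  then show ?thesis by (simp add: A_def)
qed

text \<open>Truncation at 1 maps 1 + t h back to 1, so N(1) \<le> N(1 + t h) for t > 0; the
  first-order term in t must be nonnegative. This gives the sign of the row sums.\<close>

lemma A_one_nonneg:
  assumes h: "bounded_fun h" "\<And>x. 0 \<le> h x"
  shows "0 \<le> A h 1"
proof (rule ccontr)
  assume neg: "\<not> 0 \<le> A h 1"
  \<comment> \<open>Small enough that 2 A(h, 1) + t N(h) = A(h, 1) - t is still negative; the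
    summand 1 covers N(h) = 0.\<close>
  define t where "t = - A h 1 / (N h + 1)"
  have t: "0 < t" "t * (N h + 1) = - A h 1" using neg nonneg[OF h(1)] by (auto simp: t_def divide_neg_pos)
  have "normal_contraction (\<lambda>y. min y 1)" by (auto simp: normal_contraction_def)
  from contraction[OF this, of "1 + t \<odot> h"] have "N 1 \<le> N (1 + t \<odot> h)"
    using h t by (simp add: one_fun_def)
  also have "N (1 + t \<odot> h) = N 1 + 2 * t * A h 1 + t * t * N h"
    using h A_sym[of 1 h] by (simp add: A_add A_add_right A_scl A_scl_right distrib_left flip: A_self)
  finally have "0 \<le> t * (2 * A h 1 + t * N h)" by (simp add: algebra_simps)
  then have "0 \<le> 2 * A h 1 + t * N h" using t(1) by (simp add: zero_le_mult_iff)
  then show False using t neg by (simp add: algebra_simps)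
qed

text \<open>On functions of the finite partition of \<open>X\<close> into level sets of \<open>f\<close> the form is given by a
  matrix with nonpositive off-diagonal entries and nonnegative row sums.\<close>

lemma Lf_mono_finite_range:
  assumes fin: "finite (range f)" and h: "bounded_fun h" "\<And>x. 0 \<le> h x"
    and F: "normal_contraction F"
  shows "Lf A (\<lambda>x. F (f x)) h \<le> Lf A f h"
proof -
  define R where "R = range f"
  have R: "finite R" "\<And>x. f x \<in> R" using fin by (auto simp: R_def)
  define e where "e i x = (if f x = i then 1 else 0 :: real)" for i x
  have e: "bounded_fun (e i)" for i by (intro bounded_funI[of _ 1]) (simp add: e_def)
  \<comment> \<open>The weight \<open>h\<close> sits on one side only, as in the pairing of f h with
    f, so \<open>b\<close> need not be symmetric.\<close>
  define b where "b i j = A (h * e i) (e j)" for i j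
  have sum_e: "(\<Sum>i\<in>R. \<alpha> i * e i x) = \<alpha> (f x)" for \<alpha> x
    using R by (simp add: e_def if_distrib cong: if_cong)
  have bA: "A (\<lambda>x. \<alpha> (f x) * h x) (\<lambda>x. \<beta> (f x)) = (\<Sum>i\<in>R. \<Sum>j\<in>R. \<alpha> i * \<beta> j * b i j)" for \<alpha> \<beta>
  proof -
    have 1: "(\<lambda>x. \<alpha> (f x) * h x) = (\<lambda>x. \<Sum>i\<in>R. (\<alpha> i \<odot> (h * e i)) x)"
    proof
      fix x
      have "(\<Sum>i\<in>R. (\<alpha> i \<odot> (h * e i)) x) = h x * (\<Sum>i\<in>R. \<alpha> i * e i x)"
        by (simp add: sum_distrib_left mult_ac)
      then show "\<alpha> (f x) * h x = (\<Sum>i\<in>R. (\<alpha> i \<odot> (h * e i)) x)" by (simp add: sum_e)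
    qed
    have 2: "(\<lambda>x. \<beta> (f x)) = (\<lambda>x. \<Sum>j\<in>R. (\<beta> j \<odot> e j) x)"
      by (simp add: sum_e)
    \<comment> \<open>Here the last argument \<open>0\<close> of \<open>A_sum\<close> is a
      placeholder: only the boundedness half of that lemma is used.\<close>
    have b2: "bounded_fun (\<lambda>x. \<Sum>j\<in>R. (\<beta> j \<odot> e j) x)"
      using A_sum[of R "\<lambda>j. \<beta> j \<odot> e j" 0] R e by simp
    have "A (\<lambda>x. \<Sum>i\<in>R. (\<alpha> i \<odot> (h * e i)) x) (\<lambda>x. \<Sum>j\<in>R. (\<beta> j \<odot> e j) x)
        = (\<Sum>i\<in>R. A (\<alpha> i \<odot> (h * e i)) (\<lambda>x. \<Sum>j\<in>R. (\<beta> j \<odot> e j) x))"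
      using A_sum[of R "\<lambda>i. \<alpha> i \<odot> (h * e i)", OF _ _ b2] R e h by simp
    also have "\<dots> = (\<Sum>i\<in>R. \<Sum>j\<in>R. A (\<alpha> i \<odot> (h * e i)) (\<beta> j \<odot> e j))"
    proof (rule sum.cong[OF refl])
      fix i
      have bi: "bounded_fun (\<alpha> i \<odot> (h * e i))" using h e by simp
      have "A (\<alpha> i \<odot> (h * e i)) (\<lambda>x. \<Sum>j\<in>R. (\<beta> j \<odot> e j) x)
          = A (\<lambda>x. \<Sum>j\<in>R. (\<beta> j \<odot> e j) x) (\<alpha> i \<odot> (h * e i))"
        using bi b2 by (rule A_sym)
      also have "\<dots> = (\<Sum>j\<in>R. A (\<beta> j \<odot> e j) (\<alpha> i \<odot> (h * e i)))"
        using A_sum[of R "\<lambda>j. \<beta> j \<odot> e j", OF _ _ bi] R e by simp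
      also have "\<dots> = (\<Sum>j\<in>R. A (\<alpha> i \<odot> (h * e i)) (\<beta> j \<odot> e j))"
        using bi e by (intro sum.cong refl A_sym) auto
      finally show "A (\<alpha> i \<odot> (h * e i)) (\<lambda>x. \<Sum>j\<in>R. (\<beta> j \<odot> e j) x)
          = (\<Sum>j\<in>R. A (\<alpha> i \<odot> (h * e i)) (\<beta> j \<odot> e j))" .
    qed
    also have "\<dots> = (\<Sum>i\<in>R. \<Sum>j\<in>R. \<alpha> i * \<beta> j * b i j)"
      using h e by (simp add: A_scl A_scl_right b_def mult_ac)
    finally show ?thesis unfolding 1 2 .
  qed
  have bnd: "bounded_fun (\<lambda>x. \<beta> (f x))" for \<beta>
    using A_sum[of R "\<lambda>j. \<beta> j \<odot> e j" 0] R e by (simp add: sum_e)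
  \<comment> \<open>Pairing h with G(f)^2 is the case \<open>\<alpha>\<close> = 1 of
    \<open>bA\<close>, and 2 G_i G_j - G_j^2 = G_i^2 - (G_i - G_j)^2 separates a row-sum part from a
    part that vanishes on the diagonal.\<close>
  have L: "Lf A (\<lambda>x. G (f x)) h = (\<Sum>i\<in>R. \<Sum>j\<in>R. ((G i)\<^sup>2 - (G i - G j)\<^sup>2) * b i j)" for G
  proof -
    have "A (\<lambda>x. (G (f x))\<^sup>2) h = A h (\<lambda>x. (G (f x))\<^sup>2)"
      using bnd[of "\<lambda>i. (G i)\<^sup>2"] h by (intro A_sym) auto
    then have "Lf A (\<lambda>x. G (f x)) h = (\<Sum>i\<in>R. \<Sum>j\<in>R. 2 * (G i * G j * b i j) - (G j)\<^sup>2 * b i j)"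
      unfolding Lf_def using bA[of G G] bA[of "\<lambda>_. 1" "\<lambda>i. (G i)\<^sup>2"]
      by (simp add: sum_subtractf sum_distrib_left)
    also have "\<dots> = (\<Sum>i\<in>R. \<Sum>j\<in>R. ((G i)\<^sup>2 - (G i - G j)\<^sup>2) * b i j)"
      by (intro sum.cong refl) (simp add: power2_eq_square algebra_simps)
    finally show ?thesis .
  qed
  have row: "0 \<le> (\<Sum>j\<in>R. b i j)" for i
  proof -
    have "(\<Sum>j\<in>R. b i j) = (\<Sum>j\<in>R. A (e j) (h * e i))"
      unfolding b_def using h e by (intro sum.cong refl A_sym) auto
    also have "\<dots> = A (\<lambda>x. \<Sum>j\<in>R. e j x) (h * e i)"
      using A_sum[of R e "h * e i"] R e h by simp
    also have "(\<lambda>x. \<Sum>j\<in>R. e j x) = 1"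
      using sum_e[of "\<lambda>_. 1"] by (simp add: one_fun_def)
    also have "A 1 (h * e i) = A (h * e i) 1" using h e by (intro A_sym) auto
    finally show ?thesis using A_one_nonneg[of "h * e i"] h e by (simp add: e_def)
  qed
  have off: "b i j \<le> 0" if "i \<noteq> j" for i j
    unfolding b_def using h e that by (intro A_disjoint_nonpos) (auto simp: e_def)
  \<comment> \<open>The range values of f serve as indices, so i stands for f and F i for F(f).
    Contractivity gives |F i| \<le> |i| against the row sums and |F i - F j| \<le> |i - j| against
    the off-diagonal entries.\<close>
  have "0 \<le> (\<Sum>i\<in>R. (i\<^sup>2 - (F i)\<^sup>2) * (\<Sum>j\<in>R. b i j) + (\<Sum>j\<in>R. ((F i - F j)\<^sup>2 - (i - j)\<^sup>2) * b i j))"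
  proof (intro sum_nonneg add_nonneg_nonneg)
    fix i
    have "\<bar>F i\<bar> \<le> \<bar>i\<bar>" using F by (metis diff_zero normal_contraction_def)
    then have "(F i)\<^sup>2 \<le> i\<^sup>2" by (rule abs_le_square_iff[THEN iffD1])
    then show "0 \<le> (i\<^sup>2 - (F i)\<^sup>2) * (\<Sum>j\<in>R. b i j)" using row by simp
    fix j
    show "0 \<le> ((F i - F j)\<^sup>2 - (i - j)\<^sup>2) * b i j"
    proof (cases "i = j")
      case False
      have "\<bar>F i - F j\<bar> \<le> \<bar>i - j\<bar>" using F by (simp add: normal_contraction_def)
      then have "(F i - F j)\<^sup>2 \<le> (i - j)\<^sup>2" by (rule abs_le_square_iff[THEN iffD1])
      then show ?thesis using off[OF False] by (simp add: mult_nonpos_nonpos)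
    qed simp
  qed
  also have "\<dots> = Lf A f h - Lf A (\<lambda>x. F (f x)) h"
  proof -
    have "(i\<^sup>2 - (F i)\<^sup>2) * (\<Sum>j\<in>R. b i j) + (\<Sum>j\<in>R. ((F i - F j)\<^sup>2 - (i - j)\<^sup>2) * b i j)
        = (\<Sum>j\<in>R. (i\<^sup>2 - (i - j)\<^sup>2) * b i j - ((F i)\<^sup>2 - (F i - F j)\<^sup>2) * b i j)" for i
      unfolding sum_distrib_left sum.distrib[symmetric]
      by (intro sum.cong refl) (simp add: algebra_simps)
    then show ?thesis using L[of "\<lambda>x. x"] L[of F] by (simp only: sum_subtractf)
  qed
  finally show ?thesis by simp
qed

section \<open>Uniform continuity estimates and passage from step functions to bounded
  functions\<close>

lemma A_tendsto:
  assumes u: "bounded_fun u" "\<And>n x. \<bar>us n x - u x\<bar> \<le> a n" "\<And>n. 0 < a n" "a \<longlonglongrightarrow> 0"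
    and v: "bounded_fun v" "\<And>n x. \<bar>vs n x - v x\<bar> \<le> a n"
  shows "(\<lambda>n. A (us n) (vs n)) \<longlonglongrightarrow> A u v"
proof -
  obtain U where U: "0 < U" "\<And>x. \<bar>u x\<bar> \<le> U" using bounded_fun_bound[OF u(1)] by blast
  obtain V where V: "0 < V" "\<And>x. \<bar>v x\<bar> \<le> V" using bounded_fun_bound[OF v(1)] by blast
  have bdd: "bounded_fun (us n - u)" "bounded_fun (vs n - v)" for n
    using u(2) v(2) by (auto intro!: bounded_funI[of _ "a n"])
  have us: "bounded_fun (us n)" "bounded_fun (vs n)" for n
    using bounded_fun_add[OF bdd(1) u(1), of n] bounded_fun_add[OF bdd(2) v(1), of n] by simp_all
  have "norm (A (us n) (vs n) - A u v) \<le> C * a n * (V + a n) + C * U * a n" for n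
  proof -
    have "\<bar>vs n x\<bar> \<le> V + a n" for x using V(2)[of x] v(2)[of n x] by linarith
    then have "\<bar>A (us n - u) (vs n)\<bar> \<le> C * a n * (V + a n)"
      using u(2,3) V(1) by (intro A_bound) (auto simp: add_pos_pos)
    moreover have "\<bar>A u (vs n - v)\<bar> \<le> C * U * a n"
      using U v(2) u(3) by (intro A_bound) auto
    moreover have "A (us n) (vs n) - A u v = A (us n - u) (vs n) + A u (vs n - v)"
      using us u v by (simp add: A_diff A_diff_right)
    ultimately show ?thesis by simp
  qed
  then have ev: "\<forall>\<^sub>F n in sequentially.
      norm (A (us n) (vs n) - A u v) \<le> C * a n * (V + a n) + C * U * a n"
    by (intro always_eventually allI)
  have "(\<lambda>n. C * a n * (V + a n) + C * U * a n) \<longlonglongrightarrow> C * 0 * (V + 0) + C * U * 0"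
    by (intro tendsto_intros u(4))
  then have "(\<lambda>n. C * a n * (V + a n) + C * U * a n) \<longlonglongrightarrow> 0" by simp
  with ev have "(\<lambda>n. A (us n) (vs n) - A u v) \<longlonglongrightarrow> 0"
    by (rule Lim_null_comparison)
  then show ?thesis by (simp add: LIM_zero_iff)
qed

lemma Lf_tendsto:
  assumes f: "bounded_fun f" "\<And>n x. \<bar>fs n x - f x\<bar> \<le> a n" "\<And>n. 0 < a n" "a \<longlonglongrightarrow> 0"
    and h: "bounded_fun h"
  shows "(\<lambda>n. Lf A (fs n) h) \<longlonglongrightarrow> Lf A f h"
proof -
  obtain M where M: "0 < M" "\<And>x. \<bar>f x\<bar> \<le> M" using bounded_fun_bound[OF f(1)] by blast
  obtain H where H: "0 < H" "\<And>x. \<bar>h x\<bar> \<le> H" using bounded_fun_bound[OF h] by blast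
  \<comment> \<open>One rate dominating the uniform errors a, a H and a (2 M + a) of f, f h and
    f^2.\<close>
  define c where "c n = a n * (1 + H + 2 * M + a n)" for n
  have c: "c \<longlonglongrightarrow> 0"
  proof -
    have "c \<longlonglongrightarrow> 0 * (1 + H + 2 * M + 0)" unfolding c_def by (intro tendsto_intros f(4))
    then show ?thesis by simp
  qed
  have le: "a n * 1 \<le> c n" "a n * H \<le> c n" "a n * (2 * M + a n) \<le> c n" "0 < c n" for n
    unfolding c_def using f(3)[of n] M(1) H(1) by (intro mult_left_mono mult_pos_pos; simp)+
  have fh: "\<bar>(fs n * h) x - (f * h) x\<bar> \<le> c n" for n x
  proof -
    have "\<bar>fs n x - f x\<bar> * \<bar>h x\<bar> \<le> a n * H" using f(2,3) H by (intro mult_mono) (auto simp: less_imp_le)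
    then show ?thesis using le(2)[of n] by (simp add: left_diff_distrib flip: abs_mult)
  qed
  have ff: "\<bar>(fs n * fs n) x - (f * f) x\<bar> \<le> c n" for n x
  proof -
    have "\<bar>fs n x + f x\<bar> \<le> 2 * M + a n" using f(2)[of n x] M(2)[of x] by linarith
    then have "\<bar>fs n x - f x\<bar> * \<bar>fs n x + f x\<bar> \<le> a n * (2 * M + a n)"
      using f(2,3) by (intro mult_mono) (auto simp: less_imp_le)
    then show ?thesis using le(3)[of n] by (simp add: algebra_simps flip: abs_mult)
  qed
  have f1: "\<bar>fs n x - f x\<bar> \<le> c n" for n x using f(2)[of n x] le(1)[of n] by simp
  have "(\<lambda>n. A (fs n * h) (fs n)) \<longlonglongrightarrow> A (f * h) f"
    by (rule A_tendsto[where a = c]) (use f h fh f1 le c in auto)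
  moreover have "(\<lambda>n. A (fs n * fs n) h) \<longlonglongrightarrow> A (f * f) h"
    by (rule A_tendsto[where a = c]) (use f h ff le c in \<open>auto simp: less_imp_le\<close>)
  ultimately show ?thesis unfolding Lf_alt by (intro tendsto_intros)
qed

lemma Lf_mono:
  assumes f: "bounded_fun f" and h: "bounded_fun h" "\<And>x. 0 \<le> h x"
    and F: "normal_contraction F"
  shows "Lf A (\<lambda>x. F (f x)) h \<le> Lf A f h"
proof -
  define r where "r n = 1 / real (Suc n)" for n
  have r: "0 < r n" for n by (simp add: r_def)
  have r0: "r \<longlonglongrightarrow> 0" unfolding r_def using LIMSEQ_inverse_real_of_nat by (simp add: field_simps)
  \<comment> \<open>Rounding down to the grid of mesh 1/(n+1): finitely many values, and the same
    uniform error after applying the 1-Lipschitz F.\<close>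
  define fs where "fs n x = of_int \<lfloor>real (Suc n) * f x\<rfloor> / real (Suc n)" for n x
  have fs: "\<bar>fs n x - f x\<bar> \<le> r n" for n x
  proof -
    have "\<bar>of_int \<lfloor>real (Suc n) * f x\<rfloor> - real (Suc n) * f x\<bar> \<le> 1" by linarith
    then have "\<bar>of_int \<lfloor>real (Suc n) * f x\<rfloor> - real (Suc n) * f x\<bar> / real (Suc n) \<le> 1 / real (Suc n)"
      by (rule divide_right_mono) simp
    moreover have "fs n x - f x = (of_int \<lfloor>real (Suc n) * f x\<rfloor> - real (Suc n) * f x) / real (Suc n)"
      by (simp add: fs_def field_simps)
    ultimately show ?thesis by (simp only: r_def abs_divide abs_of_nat)
  qed
  have fin: "finite (range (fs n))" for n
  proof -
    obtain M where M: "\<And>x. \<bar>f x\<bar> \<le> M" using f by (auto simp: bounded_fun_def)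
    define K where "K = real (Suc n) * M"
    have "\<bar>real (Suc n) * f x\<bar> \<le> K" for x
      using M[of x] unfolding K_def abs_mult abs_of_nat by (intro mult_left_mono) auto
    then have "\<lfloor>real (Suc n) * f x\<rfloor> \<in> {\<lfloor>- K\<rfloor>..\<lfloor>K\<rfloor>}" for x
      by (simp add: abs_le_iff) (meson floor_mono minus_le_iff)
    then have "range (fs n) \<subseteq> (\<lambda>k. of_int k / real (Suc n)) ` {\<lfloor>- K\<rfloor>..\<lfloor>K\<rfloor>}"
      unfolding fs_def by blast
    then show ?thesis by (rule finite_subset) simp
  qed
  have "(\<lambda>n. Lf A (fs n) h) \<longlonglongrightarrow> Lf A f h"
    using f fs r r0 h(1) by (rule Lf_tendsto)
  moreover have "(\<lambda>n. Lf A (\<lambda>x. F (fs n x)) h) \<longlonglongrightarrow> Lf A (\<lambda>x. F (f x)) h"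
  proof (rule Lf_tendsto)
    fix n x
    have "\<bar>F (fs n x) - F (f x)\<bar> \<le> \<bar>fs n x - f x\<bar>" using F by (simp add: normal_contraction_def)
    then show "\<bar>F (fs n x) - F (f x)\<bar> \<le> r n" using fs by (rule order_trans)
  qed (use r r0 h bounded_fun_contraction[OF F f] in auto)
  ultimately show ?thesis
    using Lf_mono_finite_range[OF fin h F] by (intro LIMSEQ_le) auto
qed

text \<open>Positivity at 1 - h gives L_f(h) \<le> L_f(1) = 2 N(f) - A(f^2, 1), and the subtracted
  term is nonnegative.\<close>

lemma Lf_le:
  assumes f: "bounded_fun f" and h: "bounded_fun h" "\<And>x. 0 \<le> h x" "\<And>x. h x \<le> 1"
  shows "Lf A f h \<le> 2 * N f"
proof -
  have "normal_contraction (\<lambda>_. 0)" by (simp add: normal_contraction_def)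
  from Lf_mono[OF f _ _ this, of "1 - h"] have "Lf A 0 (1 - h) \<le> Lf A f (1 - h)"
    using h by (simp add: zero_fun_def)
  then have "0 \<le> Lf A f (1 - h)"
    using h by (simp add: Lf_alt A_zero)
  also have "Lf A f (1 - h) = Lf A f 1 - Lf A f h"
  proof -
    have "f * (1 - h) = f - f * h" by (simp add: fun_eq_iff algebra_simps)
    then show ?thesis using f h by (simp add: Lf_alt A_diff A_diff_right)
  qed
  also have "Lf A f 1 = 2 * N f - A (f * f) 1" using f by (simp add: Lf_alt A_self)
  finally show ?thesis using A_one_nonneg[of "f * f"] f by simp
qed

end

section \<open>Products in \<open>D\<close> and transfer from the approximating forms to
  \<open>E\<close>\<close>

context contraction_form
begin

text \<open>On [-M, M] the map y^2 / (2 M) is 1-Lipschitz, since |a + b| \<le> 2 M there; clamping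
  its argument extends it to a normal contraction.\<close>

lemma D_square:
  assumes f: "f \<in> D"
  shows "f * f \<in> D"
proof -
  obtain M where M: "0 < M" "\<And>x. \<bar>f x\<bar> \<le> M" using bounded_fun_bound[OF D_bdd[OF f]] by blast
  define F where "F y = (max (- M) (min M y))\<^sup>2 / (2 * M)" for y
  have "normal_contraction F"
    unfolding normal_contraction_def
  proof (intro conjI allI)
    show "F 0 = 0" using M(1) by (simp add: F_def)
    fix x y
    define a b where "a = max (- M) (min M x)" and "b = max (- M) (min M y)"
    have ab: "\<bar>a + b\<bar> \<le> 2 * M" "\<bar>a - b\<bar> \<le> \<bar>x - y\<bar>" using M(1) by (auto simp: a_def b_def)
    have "\<bar>F x - F y\<bar> = \<bar>a + b\<bar> * \<bar>a - b\<bar> / (2 * M)"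
    proof -
      have "F x - F y = (a + b) * (a - b) / (2 * M)"
      proof -
        have "F x = a\<^sup>2 / (2 * M)" "F y = b\<^sup>2 / (2 * M)" by (simp_all only: F_def a_def b_def)
        then have "F x - F y = (a\<^sup>2 - b\<^sup>2) / (2 * M)" by (simp only: diff_divide_distrib)
        then show ?thesis by (simp only: power2_eq_square square_diff_square_factored)
      qed
      moreover have "\<bar>2 * M\<bar> = 2 * M" using M(1) by simp
      ultimately show ?thesis by (simp only: abs_mult abs_divide)
    qed
    also have "\<dots> \<le> (2 * M) * \<bar>x - y\<bar> / (2 * M)"
      using ab M(1) by (intro divide_right_mono mult_mono) auto
    finally show "\<bar>F x - F y\<bar> \<le> \<bar>x - y\<bar>" using M(1) by simp
  qed
  then have "(2 * M) \<odot> (\<lambda>x. F (f x)) \<in> D" using f by (rule D_scl[OF contraction_D])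
  moreover have "(2 * M) \<odot> (\<lambda>x. F (f x)) = f * f"
  proof
    fix x
    have "max (- M) (min M (f x)) = f x" using M(2)[of x] by (auto simp: abs_le_iff)
    then show "((2 * M) \<odot> (\<lambda>x. F (f x))) x = (f * f) x"
      using M(1) by (simp add: F_def power2_eq_square)
  qed
  ultimately show ?thesis by simp
qed

lemma D_mult [simp]:
  assumes "f \<in> D" "g \<in> D"
  shows "f * g \<in> D"
proof -
  have "f * g = (1/4) \<odot> ((f + g) * (f + g) - (f - g) * (f - g))"
    by (simp add: fun_eq_iff algebra_simps)
  then show ?thesis using assms by (simp add: D_square)
qed

lemma bounded_quadratic_form_energy:
  assumes \<nu>: "positive_functional \<nu>"
  shows "bounded_quadratic_form (energy \<nu>) (\<nu> 1)"
proof
  fix f :: "'a \<Rightarrow> real" assume f: "\<And>x. \<bar>f x\<bar> \<le> 1"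
  then have b: "bounded_fun f" by (rule bounded_funI)
  have "energy \<nu> f \<le> \<nu> (f * f)" using \<nu> b by (rule energy_le_nu)
  also have "\<dots> \<le> \<nu> 1"
  proof (rule positive_functional_mono[OF \<nu>])
    show "(f * f) x \<le> 1 x" for x
      using f[of x] abs_square_le_1[of "f x"] by (simp add: power2_eq_square)
  qed (use b in auto)
  finally show "energy \<nu> f \<le> \<nu> 1" .
qed (use \<nu> in \<open>auto intro: energy_nonneg energy_parallelogram energy_contraction\<close>)

end

context sup_closable_form
begin

text \<open>Two functions share one \<open>\<nu>\<close> so that f and F(f) can be compared under
  the same approximating form. \<open>W\<close> collects the sums and differences that polarise all
  four pairings involved.\<close>

lemma Lf_approx:
  assumes f: "f \<in> D" and g: "g \<in> D" and h: "h \<in> D" and eps: "0 < \<epsilon>"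
  obtains \<nu> where "positive_functional \<nu>"
    "\<bar>Lf (bounded_quadratic_form.A (energy \<nu>)) f h - Lf E f h\<bar> \<le> \<epsilon>"
    "\<bar>Lf (bounded_quadratic_form.A (energy \<nu>)) g h - Lf E g h\<bar> \<le> \<epsilon>"
proof -
  define P where "P = {(f * h, f), (f * f, h), (g * h, g), (g * g, h)}"
  define W where "W = (\<lambda>(u, v). u + v) ` P \<union> (\<lambda>(u, v). u - v) ` P"
  have PD: "u \<in> D" "v \<in> D" if "(u, v) \<in> P" for u v using that f g h by (auto simp: P_def)
  have "finite W" by (simp add: W_def P_def)
  moreover have "W \<subseteq> D" unfolding W_def using PD by auto
  ultimately have "\<exists>\<nu>. positive_functional \<nu> \<and> (\<forall>u\<in>W. E u u - \<epsilon> \<le> energy \<nu> u)"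
    using eps by (rule energy_approx_finite)
  then obtain \<nu> where \<nu>: "positive_functional \<nu>" "\<forall>u\<in>W. E u u - \<epsilon> \<le> energy \<nu> u"
    by (elim exE conjE)
  interpret bounded_quadratic_form "energy \<nu>" "\<nu> 1" by (rule bounded_quadratic_form_energy) fact
  have A: "\<bar>A u v - E u v\<bar> \<le> \<epsilon> / 4" if uv: "(u, v) \<in> P" for u v
  proof -
    note D = PD[OF uv]
    have "u + v \<in> W" "u - v \<in> W" using uv by (force simp: W_def)+
    then have lower: "E (u + v) (u + v) - \<epsilon> \<le> energy \<nu> (u + v)" "E (u - v) (u - v) - \<epsilon> \<le> energy \<nu> (u - v)"
      using \<nu>(2) by blast+
    have upper: "energy \<nu> (u + v) \<le> E (u + v) (u + v)" "energy \<nu> (u - v) \<le> E (u - v) (u - v)"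
      using D by (simp_all add: energy_le_E[OF \<nu>(1)])
    have polar: "E u v = (E (u + v) (u + v) - E (u - v) (u - v)) / 4"
      using D E_sym[of u v] by (simp add: E_simps)
    \<comment> \<open>Both errors are one-sided, so their difference is at most
      \<open>\<epsilon>\<close> in absolute value; the total error in \<open>Lf\<close> is then at
      most (2 + 1) \<open>\<epsilon>\<close> / 4.\<close>
    have arith: "\<bar>(p - q) / 4 - (a - b) / 4\<bar> \<le> \<epsilon> / 4"
      if "a - \<epsilon> \<le> p" "b - \<epsilon> \<le> q" "p \<le> a" "q \<le> b" for p q a b :: real
      using that by (simp add: abs_le_iff flip: diff_divide_distrib)
    show ?thesis unfolding A_def polar using lower upper by (rule arith)
  qed
  show thesis
  proof
    show "positive_functional \<nu>" by fact
    show "\<bar>Lf A f h - Lf E f h\<bar> \<le> \<epsilon>"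
      using A[of "f * h" f] A[of "f * f" h] eps unfolding Lf_alt P_def abs_le_iff by simp
    show "\<bar>Lf A g h - Lf E g h\<bar> \<le> \<epsilon>"
      using A[of "g * h" g] A[of "g * g" h] eps unfolding Lf_alt P_def abs_le_iff by simp
  qed
qed

lemma Lf_E_mono:
  assumes f: "f \<in> D" and h: "h \<in> D" "\<And>x. 0 \<le> h x" and F: "normal_contraction F"
  shows "Lf E (\<lambda>x. F (f x)) h \<le> Lf E f h"
proof (rule field_le_epsilon)
  fix \<epsilon> :: real assume "0 < \<epsilon>"
  then obtain \<nu> where \<nu>: "positive_functional \<nu>"
    "\<bar>Lf (bounded_quadratic_form.A (energy \<nu>)) f h - Lf E f h\<bar> \<le> \<epsilon> / 2"
    "\<bar>Lf (bounded_quadratic_form.A (energy \<nu>)) (\<lambda>x. F (f x)) h - Lf E (\<lambda>x. F (f x)) h\<bar> \<le> \<epsilon> / 2"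
    using Lf_approx[OF f contraction_D[OF F f] h(1), of "\<epsilon> / 2"] by auto
  interpret bounded_quadratic_form "energy \<nu>" "\<nu> 1" by (rule bounded_quadratic_form_energy) fact
  show "Lf E (\<lambda>x. F (f x)) h \<le> Lf E f h + \<epsilon>"
    using Lf_mono[OF D_bdd[OF f] D_bdd[OF h(1)] h(2) F] \<nu>(2,3) by linarith
qed

text \<open>Comparison with the zero contraction, since L vanishes at f = 0.\<close>

lemma Lf_E_nonneg:
  assumes "f \<in> D" "h \<in> D" "\<And>x. 0 \<le> h x"
  shows "0 \<le> Lf E f h"
proof -
  have "normal_contraction (\<lambda>_. 0)" by (simp add: normal_contraction_def)
  from Lf_E_mono[OF assms this] have "Lf E 0 h \<le> Lf E f h" by (simp add: zero_fun_def)
  moreover have "Lf E 0 h = 0"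
    using assms E_diff[of 0 0 h] E_diff[of 0 0 0] by (simp add: Lf_alt)
  ultimately show ?thesis by simp
qed

text \<open>The constant 1 may lie outside \<open>D\<close>, so the argument with 1 - h is made for
  the approximating form and transferred, using that \<open>energy\<close> lies below
  \<open>E\<close> on \<open>D\<close>.\<close>

lemma Lf_E_le:
  assumes f: "f \<in> D" and h: "h \<in> D" "\<And>x. 0 \<le> h x" "\<And>x. h x \<le> 1"
  shows "Lf E f h \<le> 2 * E f f"
proof (rule field_le_epsilon)
  fix \<epsilon> :: real assume "0 < \<epsilon>"
  then obtain \<nu> where \<nu>: "positive_functional \<nu>"
    "\<bar>Lf (bounded_quadratic_form.A (energy \<nu>)) f h - Lf E f h\<bar> \<le> \<epsilon>"
    using Lf_approx[OF f f h(1)] by metis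
  interpret bounded_quadratic_form "energy \<nu>" "\<nu> 1" by (rule bounded_quadratic_form_energy) fact
  show "Lf E f h \<le> 2 * E f f + \<epsilon>"
    using Lf_le[OF D_bdd[OF f] D_bdd[OF h(1)] h(2,3)] \<nu>(2) energy_le_E[OF \<nu>(1) f] by linarith
qed

text \<open>The function |h| lies in \<open>D\<close> and dominates both h and - h. Bounding L_f(h)
  by L_f(|h|) keeps the constant 2, whereas separate bounds for positive and negative part, added
  up, would give 4.\<close>

lemma abs_Lf_E_le:
  assumes f: "f \<in> D" and h: "h \<in> D" "\<And>x. \<bar>h x\<bar> \<le> 1"
  shows "\<bar>Lf E f h\<bar> \<le> 2 * E f f"
proof -
  define k where "k x = \<bar>h x\<bar>" for x
  have k: "k \<in> D" unfolding k_def using contraction_D[OF normal_contraction_abs h(1)] .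
  have eq: "f * (k + h) = f * k + f * h" "f * (k - h) = f * k - f * h"
    by (simp_all add: fun_eq_iff algebra_simps)
  have "Lf E f (k + h) = Lf E f k + Lf E f h" "Lf E f (k - h) = Lf E f k - Lf E f h"
    using f h(1) k by (simp_all add: Lf_alt eq E_simps)
  moreover have "0 \<le> Lf E f (k + h)" "0 \<le> Lf E f (k - h)"
    using f h(1) k by (intro Lf_E_nonneg; simp add: k_def)+
  moreover have "Lf E f k \<le> 2 * E f f" using f k h(2) by (intro Lf_E_le) (auto simp: k_def)
  ultimately show ?thesis by linarith
qed

end

theorem theoremT:
  fixes D :: "('a \<Rightarrow> real) set"
    and E :: "('a \<Rightarrow> real) \<Rightarrow> ('a \<Rightarrow> real) \<Rightarrow> real"
  assumes "bdd_fun_space D"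
    and "C1c_stable D"
    and "bilinear_form_on D E"
    and "sup_norm_closable D E"
    and "normal_contractions_operate D E"
  shows "\<forall>f\<in>D.
     (\<forall>h\<in>D. (\<forall>x. h x \<ge> 0) \<longrightarrow> Lf E f h \<ge> 0) \<and>
     bdd_above (dual_vals D (Lf E f)) \<and>
     dual_norm D (Lf E f) \<le> 2 * E f f \<and>
     (\<forall>F. normal_contraction F \<longrightarrow>
        (\<forall>h\<in>D. (\<forall>x. h x \<ge> 0) \<longrightarrow> Lf E f h - Lf E (\<lambda>x. F (f x)) h \<ge> 0))"
proof
  fix f assume f: "f \<in> D"
  interpret sup_closable_form D E
    using assms by unfold_locales
  have le: "v \<le> 2 * E f f" if v: "v \<in> dual_vals D (Lf E f)" for v
  proof -
    obtain h where h: "h \<in> D" "sup_norm h \<le> 1" "v = \<bar>Lf E f h\<bar>"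
      using v by (auto simp: dual_vals_def)
    obtain B where "\<And>x. \<bar>h x\<bar> \<le> B" using D_bdd[OF h(1)] by (auto simp: bounded_fun_def)
    then have "\<bar>h x\<bar> \<le> sup_norm h" for x
      unfolding sup_norm_def by (intro cSUP_upper bdd_aboveI2) auto
    then have "\<bar>h x\<bar> \<le> 1" for x using h(2) by (meson order_trans)
    then show ?thesis using abs_Lf_E_le[OF f h(1)] h(3) by simp
  qed
  \<comment> \<open>The value at h = 0 makes the set nonempty, so that its \<open>Sup\<close> is a
    genuine least upper bound.\<close>
  have "sup_norm (0 :: 'a \<Rightarrow> real) = 0" by (simp add: sup_norm_def)
  then have "dual_vals D (Lf E f) \<noteq> {}"
    unfolding dual_vals_def using D_zero by (auto intro!: exI[of _ 0])
  then have "dual_norm D (Lf E f) \<le> 2 * E f f"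
    unfolding dual_norm_def using le by (rule cSup_least)
  moreover have "bdd_above (dual_vals D (Lf E f))" using le by (rule bdd_aboveI)
  ultimately show "(\<forall>h\<in>D. (\<forall>x. h x \<ge> 0) \<longrightarrow> Lf E f h \<ge> 0) \<and>
     bdd_above (dual_vals D (Lf E f)) \<and>
     dual_norm D (Lf E f) \<le> 2 * E f f \<and>
     (\<forall>F. normal_contraction F \<longrightarrow>
        (\<forall>h\<in>D. (\<forall>x. h x \<ge> 0) \<longrightarrow> Lf E f h - Lf E (\<lambda>x. F (f x)) h \<ge> 0))"
    using Lf_E_nonneg[OF f] Lf_E_mono[OF f] by simp
qed

end
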